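(* We have $$\sup\Big\{\int_{\mathbb R}\big(e^{\pi u^2}-1\big)dx\;:\;u\in H^{\frac12,2}(\mathbb R),\ \|u\|_{H^{\frac12,2}(\mathbb R)}\le1\Big\}<\infty .$$ Moreover, for every function $h:[0,\infty)\to[0,\infty)$ with $\lim_{t\to\infty}t^{-2}h(t)=\infty$, $$\sup\Big\{\int_{\mathbb R}h(|u|)\big(e^{\pi u^2}-1\big)dx\;:\;u\in H^{\frac12,2}(\mathbb R),\ \|u\|_{H^{\frac12,2}(\mathbb R)}\le1\Big\}=\infty.$$ In particular the constant $\pi$ in the first inequality is sharp.
   Context: $(-\Delta)^{1/4}$ is the fractional Laplacian defined by $\widehat{(-\Delta)^{1/4}u}=|\xi|^{1/2}\hat u$ (in the sense of tempered distributions). $H^{\frac12,2}(\mathbb R)=\{u\in L^2(\mathbb R):(-\Delta)^{1/4}u\in L^2(\mathbb R)\}$ with norm $\|u\|^2_{H^{\frac12,2}(\mathbb R)}=\|u\|^2_{L^2(\mathbb R)}+\|(-\Delta)^{1/4}u\|^2_{L^2(\mathbb R)}$. *)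

theory Defs
  imports "HOL-Analysis.Analysis"
begin

text \<open>Unitary Fourier transform on L2, obtained as the L2-limit of truncated
  Fourier integrals; convention  Fu(xi) = (2 pi)^(-1/2) int e^(-i x xi) u(x) dx,
  under which -Delta has symbol |xi|^2 and (-Delta)^(1/4) has symbol |xi|^(1/2).\<close>

definition fourier_trunc :: "(real \<Rightarrow> real) \<Rightarrow> real \<Rightarrow> real \<Rightarrow> complex" where
  "fourier_trunc u R \<xi> =
     (LINT x:{-R..R}|lborel. cis (- (x * \<xi>)) * complex_of_real (u x))
       / complex_of_real (sqrt (2 * pi))"

definition memL2 :: "(real \<Rightarrow> real) \<Rightarrow> bool" where
  "memL2 u \<longleftrightarrow> u \<in> borel_measurable lborel \<and> integrable lborel (\<lambda>x. (u x)\<^sup>2)"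

definition is_L2_fourier :: "(real \<Rightarrow> real) \<Rightarrow> (real \<Rightarrow> complex) \<Rightarrow> bool" where
  "is_L2_fourier u v \<longleftrightarrow>
     v \<in> borel_measurable lborel \<and> integrable lborel (\<lambda>\<xi>. (cmod (v \<xi>))\<^sup>2) \<and>
     ((\<lambda>R. \<integral>\<^sup>+ \<xi>. ennreal ((cmod (v \<xi> - fourier_trunc u R \<xi>))\<^sup>2) \<partial>lborel)
        \<longlongrightarrow> 0) at_top"

definition H12 :: "(real \<Rightarrow> real) set" where
  "H12 = {u. memL2 u \<and> (\<exists>v. is_L2_fourier u v \<and>
             integrable lborel (\<lambda>\<xi>. \<bar>\<xi>\<bar> * (cmod (v \<xi>))\<^sup>2))}"

text \<open>Closed unit ball of H^{1/2,2}(R): ||u||_2^2 + ||(-Delta)^{1/4} u||_2^2 <= 1,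
  the second term computed by Plancherel as int |xi| |Fu(xi)|^2.\<close>
definition H12_unit_ball :: "(real \<Rightarrow> real) set" where
  "H12_unit_ball = {u. memL2 u \<and> (\<exists>v. is_L2_fourier u v \<and>
             integrable lborel (\<lambda>\<xi>. \<bar>\<xi>\<bar> * (cmod (v \<xi>))\<^sup>2) \<and>
             (LINT x|lborel. (u x)\<^sup>2) + (LINT \<xi>|lborel. \<bar>\<xi>\<bar> * (cmod (v \<xi>))\<^sup>2) \<le> 1)}"

end

theory Submission
  imports Defs "HOL-Probability.Probability"
begin

text \<open>Let \<open>v\<close> be the Fourier transform of \<open>u\<close> and split frequencies into the shells
  \<open>e\<^sup>k \<le> 1 + \<bar>\<xi>\<bar> < e\<^sup>k\<^sup>+\<^sup>1\<close>, with energies \<open>g\<^sub>k\<^sup>2\<close>, where the low_energy density is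
  \<open>(1 + \<bar>\<xi>\<bar>) \<bar>v\<bar>\<^sup>2\<close>. Each shell has \<open>\<integral> 1 / (1 + \<bar>\<xi>\<bar>) = 2\<close>, so by Cauchy-Schwarz the part of \<open>u\<close> of
  frequency below \<open>e\<^sup>k\<close> is at most \<open>\<pi>\<^sup>-\<^sup>1\<^sup>/\<^sup>2 (g\<^sub>0 + \<dots> + g\<^sub>k\<^sub>-\<^sub>1)\<close>, whereas the remainder has squared norm at
  most \<open>e\<^sup>-\<^sup>k L\<^sub>k\<^sup>2\<close> with \<open>L\<^sub>k\<^sup>2 = 1 - (g\<^sub>0\<^sup>2 + \<dots> + g\<^sub>k\<^sub>-\<^sub>1\<^sup>2)\<close>. Chebyshev's inequality at height \<open>L\<^sub>k\<close> then
  bounds the decreasing rearrangement of \<open>u\<close> at \<open>e\<^sup>-\<^sup>k\<close> by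
  \<open>\<pi>\<^sup>-\<^sup>1\<^sup>/\<^sup>2 (g\<^sub>0 + \<dots> + g\<^sub>k\<^sub>-\<^sub>1) + L\<^sub>k\<close>, and the claim reduces to the
  one-dimensional inequality of Moser in the form of Adams. Sharpness comes from logarithms truncated
  on the Fourier side, on which the critical integrand has mass bounded below where \<open>u\<close> is large.\<close>

section \<open>Fourier integrals of integrable functions\<close>

text \<open>Since \<open>pi\<close> is critical, the partial sums must enter with the exact
  coefficient \<open>1 / sqrt pi\<close>, and every error has to be additive and to shrink with the
  energy not yet spent. A fixed additive error would produce a cross term of order sqrt k in the
  exponent and destroy summability over k. This is why Chebyshev is applied at height L_k: the
  remainder has squared norm e^(-k) L_k^2, so the exceptional set has measure at most e^(-k), with
  no loss, while the additive error L_k tends to be small exactly when the partial sum is large. The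
  weight 1 + |xi| merges both parts of the norm into one energy and treats frequencies near 0 as an
  ordinary shell. The transform of u is given only as a limit of truncations. What links u to v is
  one inequality, that u minus the inverse transform of w is no larger in L2 than v - w for w of
  bounded support. It takes the place of an inversion theorem and rests on Plancherel for functions
  of bounded support, which is obtained by Gaussian damping.\<close>

lemma measurable_cis [measurable]: "cis \<in> borel_measurable borel"
  by (intro borel_measurable_continuous_onI continuous_intros)

lemma measurable_cnj [measurable]: "cnj \<in> borel_measurable borel"
  by (intro borel_measurable_continuous_onI continuous_intros)

text \<open>The sign \<open>s\<close> serves both directions at once: -1 is the forward and 1 the
  inverse unitary transform. Later statements cover both through
  \<open>s\<^sup>2 = 1\<close>.\<close>

definition FT :: "real \<Rightarrow> (real \<Rightarrow> complex) \<Rightarrow> real \<Rightarrow> complex" where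
  "FT s f \<xi> = (LINT x|lborel. cis (s * x * \<xi>) * f x) / complex_of_real (sqrt (2 * pi))"

text \<open>Valued in the extended reals, so that inequalities and limits can be stated before
  finiteness is known.\<close>

definition L2sq :: "(real \<Rightarrow> complex) \<Rightarrow> ennreal" where
  "L2sq f = (\<integral>\<^sup>+x. ennreal ((cmod (f x))\<^sup>2) \<partial>lborel)"

lemma fourier_trunc_eq_FT:
  "fourier_trunc u R = FT (-1) (\<lambda>x. indicator {-R..R} x *\<^sub>R complex_of_real (u x))"
  by (simp add: fun_eq_iff fourier_trunc_def FT_def set_lebesgue_integral_def mult.commute)

lemma measurable_FT [measurable]:
  assumes [measurable]: "f \<in> borel_measurable borel"
  shows "FT s f \<in> borel_measurable borel"
  unfolding FT_def[abs_def] by measurable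

lemma integrable_cis_mult:
  assumes "integrable lborel f"
  shows "integrable lborel (\<lambda>x. cis (s * x * \<xi>) * f x)"
  by (rule Bochner_Integration.integrable_bound[OF assms])
     (use assms[THEN borel_measurable_integrable] in \<open>auto simp: norm_mult\<close>)

lemma norm_FT_le: "cmod (FT s f \<xi>) \<le> (LINT x|lborel. cmod (f x)) / sqrt (2 * pi)"
proof -
  have "cmod (LINT x|lborel. cis (s * x * \<xi>) * f x) \<le> (LINT x|lborel. cmod (cis (s * x * \<xi>) * f x))"
    by (rule integral_norm_bound)
  then show ?thesis by (simp add: FT_def norm_mult norm_divide divide_right_mono)
qed

lemma FT_diff:
  assumes "integrable lborel f" "integrable lborel g"
  shows "FT s (\<lambda>x. f x - g x) \<xi> = FT s f \<xi> - FT s g \<xi>"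
  using integrable_cis_mult[OF assms(1), of s \<xi>] integrable_cis_mult[OF assms(2), of s \<xi>]
  by (simp add: FT_def right_diff_distrib diff_divide_distrib)

lemma cnj_FT: "cnj (FT s f \<xi>) = FT (-s) (\<lambda>x. cnj (f x)) \<xi>"
proof -
  have "cnj (LINT x|lborel. cis (s * x * \<xi>) * f x) = (LINT x|lborel. cnj (cis (s * x * \<xi>) * f x))"
    by (rule Bochner_Integration.integral_cnj[symmetric])
  then show ?thesis by (simp add: FT_def cis_cnj)
qed

text \<open>The kernel is symmetric in its two variables, so Fubini moves the transform from one
  factor to the other.\<close>

lemma FT_mult_formula:
  assumes f: "integrable lborel f" and g: "integrable lborel g"
  shows "(LINT x|lborel. f x * FT s g x) = (LINT x|lborel. FT s f x * g x)"
proof -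
  have [measurable]: "f \<in> borel_measurable borel" "g \<in> borel_measurable borel"
    using f g by auto
  have "integrable (lborel \<Otimes>\<^sub>M lborel) (\<lambda>(x, y). f x * g y)"
    by (intro lborel_pair.Fubini_integrable) (use f g in \<open>auto simp: norm_mult\<close>)
  then have I: "integrable (lborel \<Otimes>\<^sub>M lborel) (\<lambda>(x, y). cis (s * x * y) * f x * g y)"
    by (rule Bochner_Integration.integrable_bound) (auto simp: norm_mult)
  have "(LINT x|lborel. LINT y|lborel. cis (s * x * y) * f x * g y)
      = (LINT y|lborel. LINT x|lborel. cis (s * x * y) * f x * g y)"
    using lborel_pair.Fubini_integral[OF I] by simp
  moreover have "(LINT y|lborel. cis (s * x * y) * f x * g y) = f x * (LINT y|lborel. cis (s * y * x) * g y)" for x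
    by (subst integral_mult_right_zero[symmetric]) (simp add: mult_ac)
  moreover have "(LINT x|lborel. cis (s * x * y) * f x * g y) = (LINT x|lborel. cis (s * x * y) * f x) * g y" for y
    by simp
  ultimately show ?thesis by (simp add: FT_def)
qed

text \<open>The Gaussian has width 1/\<sigma> so that its transform is a multiple of the normal
  density of deviation \<sigma>. As \<sigma> tends to 0 the damping disappears and the density
  becomes an approximate identity.\<close>

lemma integral_cis_gaussian:
  assumes "\<sigma> > 0"
  shows "(LINT x|lborel. cis (t * x) * complex_of_real (exp (- (\<sigma> * x)\<^sup>2 / 2)))
     = complex_of_real (2 * pi * normal_density 0 \<sigma> t)"
proof -
  have "complex_of_real (exp (- ((t / \<sigma>)\<^sup>2) / 2)) = char std_normal_distribution (t / \<sigma>)"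
    by (simp add: char_std_normal_distribution)
  also have "\<dots> = (LINT x|lborel. std_normal_density x *\<^sub>R cis (t / \<sigma> * x))"
    unfolding char_def by (subst integral_density) (auto simp: cis_conv_exp)
  also have "\<dots> = \<bar>\<sigma>\<bar> *\<^sub>R (LINT x|lborel. std_normal_density (0 + \<sigma> * x) *\<^sub>R cis (t / \<sigma> * (0 + \<sigma> * x)))"
    using assms by (subst lborel_integral_real_affine[of \<sigma> _ 0]) auto
  also have "\<dots> = (\<sigma> / sqrt (2 * pi)) *\<^sub>R (LINT x|lborel. cis (t * x) * complex_of_real (exp (- (\<sigma> * x)\<^sup>2 / 2)))"
    using assms by (simp add: std_normal_density_def scaleR_conv_of_real mult_ac)
  finally have "(LINT x|lborel. cis (t * x) * complex_of_real (exp (- (\<sigma> * x)\<^sup>2 / 2)))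
     = complex_of_real (sqrt (2 * pi) / \<sigma> * exp (- ((t / \<sigma>)\<^sup>2) / 2))"
    using assms by (simp add: scaleR_conv_of_real field_simps)
  also have "sqrt (2 * pi) / \<sigma> * exp (- ((t / \<sigma>)\<^sup>2) / 2) = 2 * pi * normal_density 0 \<sigma> t"
    using assms by (simp add: normal_density_def real_sqrt_mult power_divide field_simps)
  finally show ?thesis .
qed

lemma integrable_gaussian:
  fixes \<sigma> :: real
  assumes "\<sigma> > 0" shows "integrable lborel (\<lambda>x. exp (- (\<sigma> * x)\<^sup>2 / 2))"
proof -
  have "integrable lborel (\<lambda>x. sqrt (2 * pi) * std_normal_density (0 + \<sigma> * x))"
    using assms by (intro integrable_mult_right lborel_integrable_real_affine) auto
  then show ?thesis by (simp add: std_normal_density_def)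
qed

text \<open>Damping by a Gaussian makes the double application of the multiplication formula legitimate.\<close>
lemma FT_gaussian_energy:
  assumes f: "integrable lborel f" and s: "s\<^sup>2 = 1" and \<sigma>: "\<sigma> > 0"
  shows "(LINT x|lborel. complex_of_real ((cmod (FT s f x))\<^sup>2 * exp (- (\<sigma> * x)\<^sup>2 / 2)))
     = (LINT x|lborel. f x * (LINT y|lborel. cnj (f y) * complex_of_real (normal_density 0 \<sigma> (x - y))))"
proof -
  have [measurable]: "f \<in> borel_measurable borel"
    using f by auto
  have cf: "integrable lborel (\<lambda>x. cnj (f x))" using f by simp
  define E where "E x = complex_of_real (exp (- (\<sigma> * x)\<^sup>2 / 2))" for x
  have E: "integrable lborel E"
    unfolding E_def[abs_def] using integrable_gaussian[OF \<sigma>] by simp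
  have [measurable]: "E \<in> borel_measurable borel" using E by auto
  define M where "M = (LINT x|lborel. cmod (f x)) / sqrt (2 * pi)"
  have \<phi>: "integrable lborel (\<lambda>x. cnj (FT s f x) * E x)"
  proof (rule Bochner_Integration.integrable_bound)
    show "integrable lborel (\<lambda>x. complex_of_real M * E x)" using E by simp
    have "cmod (FT s f x) \<le> \<bar>M\<bar>" for x
      using norm_FT_le[of s f x] by (simp add: M_def)
    then show "AE x in lborel. norm (cnj (FT s f x) * E x) \<le> norm (complex_of_real M * E x)"
      by (auto simp: norm_mult mult_right_mono)
  qed measurable
  have E2: "integrable lborel (\<lambda>y. cis (s * y * x) * E y)" for x
    using E by (rule integrable_cis_mult)
  \<comment> \<open>Modulation turns into translation: the transform of the modulated Gaussian is a
    bump centred at \<open>x\<close>.\<close>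
  have A: "FT (-s) (\<lambda>y. cis (s * y * x) * E y) z = complex_of_real (sqrt (2 * pi) * normal_density 0 \<sigma> (x - z))" for x z
  proof -
    have "FT (-s) (\<lambda>y. cis (s * y * x) * E y) z = (LINT y|lborel. cis (s * (x - z) * y) * E y) / complex_of_real (sqrt (2 * pi))"
      unfolding FT_def mult.assoc[symmetric] cis_mult by (simp add: algebra_simps)
    also have "\<dots> = complex_of_real (2 * pi * normal_density 0 \<sigma> (s * (x - z)) / sqrt (2 * pi))"
      unfolding E_def integral_cis_gaussian[OF \<sigma>] by simp
    also have "2 * pi * normal_density 0 \<sigma> (s * (x - z)) / sqrt (2 * pi) = sqrt (2 * pi) * normal_density 0 \<sigma> (s * (x - z))"
      by (simp add: field_simps flip: power2_eq_square)
    also have "normal_density 0 \<sigma> (s * (x - z)) = normal_density 0 \<sigma> (x - z)"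
      using s by (simp add: normal_density_def power_mult_distrib)
    finally show ?thesis .
  qed
  have B: "FT s (\<lambda>x. cnj (FT s f x) * E x) x = (LINT y|lborel. cnj (f y) * complex_of_real (normal_density 0 \<sigma> (x - y)))" for x
  proof -
    have "FT s (\<lambda>x. cnj (FT s f x) * E x) x
       = (LINT y|lborel. FT (-s) (\<lambda>x. cnj (f x)) y * (cis (s * y * x) * E y)) / complex_of_real (sqrt (2 * pi))"
      by (subst FT_def) (simp add: cnj_FT mult_ac)
    also have "\<dots> = (LINT y|lborel. cnj (f y) * complex_of_real (normal_density 0 \<sigma> (x - y)))"
      unfolding FT_mult_formula[OF cf E2, symmetric] A of_real_mult mult.left_commute[of "cnj _"]
      by simp
    finally show ?thesis .
  qed
  have "(LINT x|lborel. complex_of_real ((cmod (FT s f x))\<^sup>2 * exp (- (\<sigma> * x)\<^sup>2 / 2)))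
      = (LINT x|lborel. FT s f x * (cnj (FT s f x) * E x))"
    by (simp add: E_def complex_norm_square[unfolded of_real_power] mult_ac)
  also have "\<dots> = (LINT x|lborel. f x * FT s (\<lambda>x. cnj (FT s f x) * E x) x)"
    by (rule FT_mult_formula[OF f \<phi>, symmetric])
  finally show ?thesis unfolding B .
qed

section \<open>Bessel and Plancherel\<close>

lemma norm_integral_le_nn_integral:
  fixes f :: "'a \<Rightarrow> 'b::{banach, second_countable_topology}"
  shows "ennreal (norm (integral\<^sup>L M f)) \<le> (\<integral>\<^sup>+x. ennreal (norm (f x)) \<partial>M)"
proof (cases "integrable M f")
  \<comment> \<open>The Bochner integral of a non-integrable function is 0 by default.\<close>
  case False
  then show ?thesis by (simp add: not_integrable_integral_eq)
qed (rule integral_norm_bound_ennreal)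

lemma L2sq_eq_integral:
  assumes "integrable lborel (\<lambda>x. (cmod (f x))\<^sup>2)"
  shows "L2sq f = ennreal (LINT x|lborel. (cmod (f x))\<^sup>2)"
  unfolding L2sq_def by (rule nn_integral_eq_integral[OF assms]) auto

lemma L2sq_less_top_iff:
  assumes "f \<in> borel_measurable borel"
  shows "L2sq f < \<top> \<longleftrightarrow> integrable lborel (\<lambda>x. (cmod (f x))\<^sup>2)"
  using assms by (auto simp: L2sq_def integrable_iff_bounded)

lemma nn_integral_normal_density:
  "(\<integral>\<^sup>+y. ennreal (normal_density 0 \<sigma> (x - y)) \<partial>lborel) = 1" (is ?A)
  "(\<integral>\<^sup>+y. ennreal (normal_density 0 \<sigma> (y - x)) \<partial>lborel) = 1" (is ?B) if "\<sigma> > 0"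
proof -
  interpret prob_space "density lborel (normal_density 0 \<sigma>)"
    by (rule prob_space_normal_density[OF that])
  have 1: "(\<integral>\<^sup>+y. ennreal (normal_density 0 \<sigma> y) \<partial>lborel) = 1"
    using emeasure_space_1 by (simp add: emeasure_density)
  show ?A using 1
    by (subst (asm) nn_integral_real_affine[of _ "-1" x]) auto
  show ?B using 1
    by (subst (asm) nn_integral_real_affine[of _ 1 "-x"]) auto
qed

text \<open>A Schur test: ab \<le> a^2/2 + b^2/2 separates the variables, and the density integrates
  to 1 in each of them.\<close>

lemma nn_integral_gaussian_pairing_le:
  assumes [measurable]: "f \<in> borel_measurable borel" and \<sigma>: "\<sigma> > 0"
  shows "(\<integral>\<^sup>+x. ennreal (cmod (f x)) * (\<integral>\<^sup>+y. ennreal (cmod (f y) * normal_density 0 \<sigma> (x - y)) \<partial>lborel) \<partial>lborel) \<le> L2sq f"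
proof -
  define q where "q x = ennreal ((cmod (f x))\<^sup>2 / 2)" for x
  have [measurable]: "q \<in> borel_measurable borel" unfolding q_def[abs_def] by measurable
  let ?n = "\<lambda>x y. ennreal (normal_density 0 \<sigma> (x - y))"
  have le: "ennreal (cmod (f x)) * ennreal (cmod (f y) * normal_density 0 \<sigma> (x - y))
      \<le> q x * ?n x y + q y * ?n x y" for x y
  proof -
    have "cmod (f x) * (cmod (f y) * normal_density 0 \<sigma> (x - y))
       = (cmod (f x) * cmod (f y)) * normal_density 0 \<sigma> (x - y)" by simp
    also have "\<dots> \<le> ((cmod (f x))\<^sup>2 / 2 + (cmod (f y))\<^sup>2 / 2) * normal_density 0 \<sigma> (x - y)"
      using sum_squares_bound[of "cmod (f x)" "cmod (f y)"]
      by (intro mult_right_mono) auto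
    finally have "ennreal (cmod (f x) * (cmod (f y) * normal_density 0 \<sigma> (x - y))) \<le> ennreal \<dots>"
      by (rule ennreal_leI)
    then show ?thesis by (simp add: q_def ennreal_mult[symmetric] distrib_right flip: ennreal_plus)
  qed
  have "(\<integral>\<^sup>+x. ennreal (cmod (f x)) * (\<integral>\<^sup>+y. ennreal (cmod (f y) * normal_density 0 \<sigma> (x - y)) \<partial>lborel) \<partial>lborel)
    = (\<integral>\<^sup>+x. (\<integral>\<^sup>+y. ennreal (cmod (f x)) * ennreal (cmod (f y) * normal_density 0 \<sigma> (x - y)) \<partial>lborel) \<partial>lborel)"
    by (subst nn_integral_cmult) auto
  also have "\<dots> \<le> (\<integral>\<^sup>+x. (\<integral>\<^sup>+y. q x * ?n x y + q y * ?n x y \<partial>lborel) \<partial>lborel)"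
    by (intro nn_integral_mono le)
  also have "\<dots> = (\<integral>\<^sup>+x. (\<integral>\<^sup>+y. q x * ?n x y \<partial>lborel) \<partial>lborel) + (\<integral>\<^sup>+x. (\<integral>\<^sup>+y. q y * ?n x y \<partial>lborel) \<partial>lborel)"
    by (subst nn_integral_add[symmetric]) (auto intro!: nn_integral_cong simp: nn_integral_add)
  also have "(\<integral>\<^sup>+x. (\<integral>\<^sup>+y. q y * ?n x y \<partial>lborel) \<partial>lborel) = (\<integral>\<^sup>+y. (\<integral>\<^sup>+x. q y * ?n x y \<partial>lborel) \<partial>lborel)"
    by (intro lborel_pair.Fubini') measurable
  also have "\<dots> = (\<integral>\<^sup>+y. q y \<partial>lborel)"
    by (simp add: nn_integral_cmult nn_integral_normal_density \<sigma>)
  also have "(\<integral>\<^sup>+x. (\<integral>\<^sup>+y. q x * ?n x y \<partial>lborel) \<partial>lborel) = (\<integral>\<^sup>+y. q y \<partial>lborel)"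
    by (simp add: nn_integral_cmult nn_integral_normal_density \<sigma>)
  also have "(\<integral>\<^sup>+y. q y \<partial>lborel) + (\<integral>\<^sup>+y. q y \<partial>lborel) = L2sq f"
    unfolding L2sq_def by (subst nn_integral_add[symmetric]) (auto simp: q_def simp flip: ennreal_plus)
  finally show ?thesis .
qed

lemma integrable_FT_gaussian:
  assumes "integrable lborel f" and \<sigma>: "\<sigma> > 0"
  shows "integrable lborel (\<lambda>x. (cmod (FT s f x))\<^sup>2 * exp (- (\<sigma> * x)\<^sup>2 / 2))"
proof (rule Bochner_Integration.integrable_bound)
  have [measurable]: "f \<in> borel_measurable borel" using assms by auto
  define M where "M = (LINT x|lborel. cmod (f x)) / sqrt (2 * pi)"
  show "integrable lborel (\<lambda>x. M\<^sup>2 * exp (- (\<sigma> * x)\<^sup>2 / 2))"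
    using integrable_gaussian[OF \<sigma>] by simp
  have "(cmod (FT s f x))\<^sup>2 \<le> M\<^sup>2" for x
    using norm_FT_le[of s f x] by (intro power_mono) (auto simp: M_def)
  then show "AE x in lborel. norm ((cmod (FT s f x))\<^sup>2 * exp (- (\<sigma> * x)\<^sup>2 / 2)) \<le> norm (M\<^sup>2 * exp (- (\<sigma> * x)\<^sup>2 / 2))"
    by (auto intro!: mult_right_mono)
  show "(\<lambda>x. (cmod (FT s f x))\<^sup>2 * exp (- (\<sigma> * x)\<^sup>2 / 2)) \<in> borel_measurable lborel"
    by measurable
qed

text \<open>The Gaussian pairing bounds every damped energy by \<open>L2sq f\<close>. Fatou's lemma
  then removes the damping along \<sigma> = 1/(n+1). If \<open>f\<close> is not square integrable,
  the right side is infinite.\<close>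

lemma Bessel_FT:
  assumes f: "integrable lborel f" and s: "s\<^sup>2 = 1"
  shows "L2sq (FT s f) \<le> L2sq f"
proof -
  have [measurable]: "f \<in> borel_measurable borel" using f by auto
  define E where "E n x = exp (- (1 / real (Suc n) * x)\<^sup>2 / 2)" for n x
  have [measurable]: "E n \<in> borel_measurable borel" for n unfolding E_def[abs_def] by measurable
  have bound: "(\<integral>\<^sup>+x. ennreal ((cmod (FT s f x))\<^sup>2 * E n x) \<partial>lborel) \<le> L2sq f" for n
  proof -
    let ?\<sigma> = "1 / real (Suc n)"
    have \<sigma>: "?\<sigma> > 0" by simp
    have "(\<integral>\<^sup>+x. ennreal ((cmod (FT s f x))\<^sup>2 * E n x) \<partial>lborel) = ennreal (LINT x|lborel. (cmod (FT s f x))\<^sup>2 * E n x)"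
      unfolding E_def by (rule nn_integral_eq_integral[OF integrable_FT_gaussian[OF f \<sigma>]]) auto
    also have "\<dots> \<le> ennreal (cmod (LINT x|lborel. complex_of_real ((cmod (FT s f x))\<^sup>2 * E n x)))"
      unfolding Bochner_Integration.integral_complex_of_real norm_of_real by (intro ennreal_leI abs_ge_self)
    also have "\<dots> \<le> (\<integral>\<^sup>+x. ennreal (cmod (f x * (LINT y|lborel. cnj (f y) * complex_of_real (normal_density 0 ?\<sigma> (x - y))))) \<partial>lborel)"
      unfolding E_def FT_gaussian_energy[OF f s \<sigma>] by (rule norm_integral_le_nn_integral)
    also have "\<dots> \<le> (\<integral>\<^sup>+x. ennreal (cmod (f x)) * (\<integral>\<^sup>+y. ennreal (cmod (f y) * normal_density 0 ?\<sigma> (x - y)) \<partial>lborel) \<partial>lborel)"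
    proof (rule nn_integral_mono)
      fix x
      have "ennreal (cmod (LINT y|lborel. cnj (f y) * complex_of_real (normal_density 0 ?\<sigma> (x - y))))
        \<le> (\<integral>\<^sup>+y. ennreal (cmod (f y) * normal_density 0 ?\<sigma> (x - y)) \<partial>lborel)"
        by (rule order_trans[OF norm_integral_le_nn_integral]) (simp add: norm_mult)
      then show "ennreal (cmod (f x * (LINT y|lborel. cnj (f y) * complex_of_real (normal_density 0 ?\<sigma> (x - y)))))
        \<le> ennreal (cmod (f x)) * (\<integral>\<^sup>+y. ennreal (cmod (f y) * normal_density 0 ?\<sigma> (x - y)) \<partial>lborel)"
        by (simp add: norm_mult ennreal_mult mult_left_mono)
    qed
    also have "\<dots> \<le> L2sq f" by (rule nn_integral_gaussian_pairing_le[OF _ \<sigma>]) simp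
    finally show ?thesis .
  qed
  have lim: "(\<lambda>n. (cmod (FT s f x))\<^sup>2 * E n x) \<longlonglongrightarrow> (cmod (FT s f x))\<^sup>2 * exp (- (0 * x)\<^sup>2 / 2)" for x
    unfolding E_def by (intro tendsto_intros LIMSEQ_Suc lim_1_over_n) auto
  have "L2sq (FT s f) = (\<integral>\<^sup>+x. liminf (\<lambda>n. ennreal ((cmod (FT s f x))\<^sup>2 * E n x)) \<partial>lborel)"
    unfolding L2sq_def
  proof (rule nn_integral_cong)
    fix x
    have "(\<lambda>n. ennreal ((cmod (FT s f x))\<^sup>2 * E n x)) \<longlonglongrightarrow> ennreal ((cmod (FT s f x))\<^sup>2)"
      using lim[of x] by (intro tendsto_ennrealI) auto
    from lim_imp_Liminf[OF _ this] 
    show "ennreal ((cmod (FT s f x))\<^sup>2) = liminf (\<lambda>n. ennreal ((cmod (FT s f x))\<^sup>2 * E n x))" by simp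
  qed
  also have "\<dots> \<le> liminf (\<lambda>n. (\<integral>\<^sup>+x. ennreal ((cmod (FT s f x))\<^sup>2 * E n x) \<partial>lborel))"
    by (rule nn_integral_liminf) measurable
  also have "\<dots> \<le> liminf (\<lambda>n::nat. L2sq f)"
    by (intro Liminf_mono always_eventually allI bound)
  finally show ?thesis by (simp add: Liminf_const)
qed

text \<open>Moves \<sigma> from the density into the argument of \<open>g\<close>, where dominated
  convergence can let it tend to 0.\<close>

lemma gaussian_mean_rescale:
  assumes "\<sigma> > 0"
  shows "(LINT y|lborel. g y * complex_of_real (normal_density 0 \<sigma> (x - y)))
       = (LINT z|lborel. g (x + \<sigma> * z) * complex_of_real (std_normal_density z))"
proof -
  have "(LINT y|lborel. g y * complex_of_real (normal_density 0 \<sigma> (x - y)))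
    = \<bar>\<sigma>\<bar> *\<^sub>R (LINT z|lborel. g (x + \<sigma> * z) * complex_of_real (normal_density 0 \<sigma> (x - (x + \<sigma> * z))))"
    using assms by (intro lborel_integral_real_affine) auto
  also have "\<dots> = (LINT z|lborel. \<bar>\<sigma>\<bar> *\<^sub>R (g (x + \<sigma> * z) * complex_of_real (normal_density 0 \<sigma> (x - (x + \<sigma> * z)))))"
    by simp
  also have "\<dots> = (LINT z|lborel. g (x + \<sigma> * z) * complex_of_real (std_normal_density z))"
  proof (rule Bochner_Integration.integral_cong)
    fix z
    have "\<sigma> * normal_density 0 \<sigma> (x - (x + \<sigma> * z)) = std_normal_density z"
      using assms by (simp add: normal_density_def real_sqrt_mult power_mult_distrib field_simps)
    then show "\<bar>\<sigma>\<bar> *\<^sub>R (g (x + \<sigma> * z) * complex_of_real (normal_density 0 \<sigma> (x - (x + \<sigma> * z))))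
      = g (x + \<sigma> * z) * complex_of_real (std_normal_density z)"
      using assms by (simp add: scaleR_conv_of_real mult_ac flip: of_real_mult)
  qed simp
  finally show ?thesis .
qed

text \<open>Bessel is one half. For the other, Gaussian means of a bounded continuous function
  converge pointwise, so the pairing tends to the energy of \<open>f\<close>, while each damped
  energy stays below that of the transform.\<close>

lemma Plancherel_continuous:
  assumes cont: "continuous_on UNIV f" and B: "\<And>x. cmod (f x) \<le> B"
    and f: "integrable lborel f" and s: "s\<^sup>2 = 1"
  shows "L2sq (FT s f) = L2sq f"
proof (rule antisym[OF Bessel_FT[OF f s]])
  have B0: "0 \<le> B" using B[of 0] norm_ge_zero order_trans by blast
  have [measurable]: "f \<in> borel_measurable borel" using f by auto
  define \<sigma> where "\<sigma> n = 1 / real (Suc n)" for n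
  have \<sigma>: "\<sigma> n > 0" for n by (simp add: \<sigma>_def)
  have \<sigma>0: "\<sigma> \<longlonglongrightarrow> 0" unfolding \<sigma>_def by (intro LIMSEQ_Suc lim_1_over_n)
  define m where "m n x = (LINT z|lborel. cnj (f (x + \<sigma> n * z)) * complex_of_real (std_normal_density z))" for n x
  have m_le: "cmod (m n x) \<le> B" for n x
  proof -
    have "cmod (m n x) \<le> (LINT z|lborel. B * std_normal_density z)"
      unfolding m_def
    proof (rule Bochner_Integration.integral_norm_bound_integral)
      show "integrable lborel (\<lambda>z. cnj (f (x + \<sigma> n * z)) * complex_of_real (std_normal_density z))"
        by (rule Bochner_Integration.integrable_bound[where f = "\<lambda>z. B * std_normal_density z"])
           (auto simp: norm_mult B0 intro!: mult_right_mono B)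
    qed (auto simp: norm_mult B intro!: mult_right_mono)
    then show ?thesis by simp
  qed
  have m_lim: "(\<lambda>n. m n x) \<longlonglongrightarrow> cnj (f x)" for x
  proof -
    have "(\<lambda>n. m n x) \<longlonglongrightarrow> (LINT z|lborel. cnj (f x) * complex_of_real (std_normal_density z))"
      unfolding m_def
    proof (rule integral_dominated_convergence[where w = "\<lambda>z. B * std_normal_density z"])
      have "(\<lambda>n. f (x + \<sigma> n * z)) \<longlonglongrightarrow> f (x + 0 * z)" for z
        by (rule continuous_on_tendsto_compose[OF cont tendsto_add[OF tendsto_const tendsto_mult[OF \<sigma>0 tendsto_const]]]) auto
      then show "AE z in lborel. (\<lambda>n. cnj (f (x + \<sigma> n * z)) * complex_of_real (std_normal_density z))
          \<longlonglongrightarrow> cnj (f x) * complex_of_real (std_normal_density z)"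
        by (intro always_eventually allI tendsto_intros) auto
    qed (auto simp: norm_mult B intro!: mult_right_mono)
    then show ?thesis by simp
  qed
  have [measurable]: "m n \<in> borel_measurable borel" for n unfolding m_def[abs_def] by measurable
  have "(\<lambda>n. LINT x|lborel. f x * m n x) \<longlonglongrightarrow> (LINT x|lborel. f x * cnj (f x))"
  proof (rule integral_dominated_convergence[where w = "\<lambda>x. B * cmod (f x)"])
    show "integrable lborel (\<lambda>x. B * cmod (f x))" using f by simp
    show "AE x in lborel. cmod (f x * m n x) \<le> B * cmod (f x)" for n
      by (auto simp: norm_mult mult.commute[of B] intro!: mult_left_mono m_le)
    show "AE x in lborel. (\<lambda>n. f x * m n x) \<longlonglongrightarrow> f x * cnj (f x)"
      by (intro always_eventually allI tendsto_intros m_lim)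
  qed measurable
  then have lim: "(\<lambda>n. ennreal (cmod (LINT x|lborel. f x * m n x))) \<longlonglongrightarrow> ennreal (cmod (LINT x|lborel. f x * cnj (f x)))"
    by (intro tendsto_ennrealI tendsto_norm)
  have le: "ennreal (cmod (LINT x|lborel. f x * m n x)) \<le> L2sq (FT s f)" for n
  proof -
    have "(LINT x|lborel. f x * m n x) = (LINT x|lborel. complex_of_real ((cmod (FT s f x))\<^sup>2 * exp (- (\<sigma> n * x)\<^sup>2 / 2)))"
      unfolding m_def FT_gaussian_energy[OF f s \<sigma>] gaussian_mean_rescale[OF \<sigma>] ..
    also have "ennreal (cmod \<dots>) \<le> (\<integral>\<^sup>+x. ennreal (cmod (complex_of_real ((cmod (FT s f x))\<^sup>2 * exp (- (\<sigma> n * x)\<^sup>2 / 2)))) \<partial>lborel)"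
      by (rule norm_integral_le_nn_integral)
    also have "\<dots> \<le> L2sq (FT s f)"
      unfolding L2sq_def norm_of_real
      by (intro nn_integral_mono ennreal_leI) (auto intro!: mult_left_le)
    finally show ?thesis .
  qed
  have "ennreal (cmod (LINT x|lborel. f x * cnj (f x))) \<le> L2sq (FT s f)"
    using LIMSEQ_le_const2[OF lim] le by blast
  moreover have "L2sq f = ennreal (cmod (LINT x|lborel. f x * cnj (f x)))"
  proof -
    have "integrable lborel (\<lambda>x. (cmod (f x))\<^sup>2)"
      by (rule Bochner_Integration.integrable_bound[where f = "\<lambda>x. B * cmod (f x)"])
         (use f B B0 in \<open>auto simp: power2_eq_square intro!: mult_right_mono\<close>)
    moreover have "(LINT x|lborel. f x * cnj (f x)) = complex_of_real (LINT x|lborel. (cmod (f x))\<^sup>2)"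
      unfolding complex_norm_square[symmetric] integral_complex_of_real ..
    ultimately show ?thesis by (simp add: L2sq_eq_integral)
  qed
  ultimately show "L2sq f \<le> L2sq (FT s f)" by simp
qed

section \<open>Stability of squared L2 norms under L2 convergence\<close>

lemma cmod_sq_le_delta:
  assumes "\<delta> > 0" and that: "c = a \<or> c = b"
  shows "(cmod a)\<^sup>2 \<le> (cmod b)\<^sup>2 + \<delta> * (cmod c)\<^sup>2 + (1 + 1 / \<delta>) * (cmod (a - b))\<^sup>2"
proof -
  define d where "d = cmod (a - b)"
  have d0: "0 \<le> d" and ab: "cmod a \<le> cmod b + d" "cmod b \<le> cmod a + d"
    using norm_triangle_ineq[of b "a - b"] norm_triangle_ineq[of a "b - a"]
    by (auto simp: d_def norm_minus_commute)
  have amgm: "2 * x * d \<le> \<delta> * x\<^sup>2 + 1 / \<delta> * d\<^sup>2" for x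
  proof -
    have "0 \<le> (\<delta> * x - d)\<^sup>2 / \<delta>" using assms by simp
    also have "\<dots> = \<delta> * x\<^sup>2 + 1 / \<delta> * d\<^sup>2 - 2 * x * d"
      using assms by (simp add: power2_eq_square field_simps)
    finally show ?thesis by simp
  qed
  show ?thesis
  proof (cases "c = b")
    case True
    have "(cmod a)\<^sup>2 \<le> (cmod b + d)\<^sup>2" using ab by (intro power_mono) auto
    also have "\<dots> = (cmod b)\<^sup>2 + 2 * cmod b * d + d\<^sup>2" by (simp add: power2_sum)
    finally show ?thesis using amgm[of "cmod b"] True by (simp add: d_def distrib_right)
  next
    case False
    then have "c = a" using that by simp
    have "(cmod a)\<^sup>2 - (cmod b)\<^sup>2 \<le> 2 * cmod a * d"
    \<comment> \<open>Squaring |a| - d \<le> |b| requires a nonnegative left side. If |a| < d, then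
      |a|^2 \<le> |a| d is already enough.\<close>
    proof (cases "cmod a \<ge> d")
      case True
      then have "(cmod a - d)\<^sup>2 \<le> (cmod b)\<^sup>2" using ab by (intro power_mono) auto
      then show ?thesis using zero_le_power2[of d] unfolding power2_diff by linarith
    next
      case False
      then have "(cmod a)\<^sup>2 \<le> cmod a * d" unfolding power2_eq_square by (intro mult_left_mono) auto
      then show ?thesis using mult_nonneg_nonneg[OF norm_ge_zero[of a] d0] zero_le_power2[of "cmod b"]
        by linarith
    qed
    then show ?thesis
      using amgm[of "cmod a"] zero_le_power2[of d]
      unfolding \<open>c = a\<close> d_def[symmetric] distrib_right mult_1_left by linarith
  qed
qed

text \<open>Stands in for the triangle inequality without roots or subtraction in the extended
  reals. The small term may be charged to either function, so a limit argument can charge it to the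
  fixed limit each time.\<close>

lemma L2sq_le_delta:
  assumes [measurable]: "f \<in> borel_measurable borel" "g \<in> borel_measurable borel" "h \<in> borel_measurable borel"
    and \<delta>: "\<delta> > 0" and h: "h = f \<or> h = g"
  shows "L2sq f \<le> L2sq g + ennreal \<delta> * L2sq h + ennreal (1 + 1 / \<delta>) * L2sq (\<lambda>x. f x - g x)"
proof -
  have "L2sq f \<le> (\<integral>\<^sup>+x. ennreal ((cmod (g x))\<^sup>2) + ennreal \<delta> * ennreal ((cmod (h x))\<^sup>2)
       + ennreal (1 + 1 / \<delta>) * ennreal ((cmod (f x - g x))\<^sup>2) \<partial>lborel)"
    unfolding L2sq_def
  proof (rule nn_integral_mono)
    fix x
    have "(cmod (f x))\<^sup>2 \<le> (cmod (g x))\<^sup>2 + \<delta> * (cmod (h x))\<^sup>2 + (1 + 1 / \<delta>) * (cmod (f x - g x))\<^sup>2"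
      using \<delta> h by (intro cmod_sq_le_delta) auto
    from ennreal_leI[OF this] show "ennreal ((cmod (f x))\<^sup>2) \<le> ennreal ((cmod (g x))\<^sup>2) + ennreal \<delta> * ennreal ((cmod (h x))\<^sup>2)
       + ennreal (1 + 1 / \<delta>) * ennreal ((cmod (f x - g x))\<^sup>2)"
      using \<delta> by (simp add: ennreal_mult[symmetric] flip: ennreal_plus)
  qed
  also have "\<dots> = L2sq g + ennreal \<delta> * L2sq h + ennreal (1 + 1 / \<delta>) * L2sq (\<lambda>x. f x - g x)"
    unfolding L2sq_def by (simp add: nn_integral_add nn_integral_cmult)
  finally show ?thesis .
qed

lemma L2sq_tendsto:
  assumes [measurable]: "\<And>n. f n \<in> borel_measurable borel" "g \<in> borel_measurable borel"
    and g: "L2sq g < \<top>" and lim: "((\<lambda>n. L2sq (\<lambda>x. f n x - g x)) \<longlongrightarrow> 0) F"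
  shows "((\<lambda>n. L2sq (f n)) \<longlongrightarrow> L2sq g) F"
proof -
  define d where "d n = enn2real (L2sq (\<lambda>x. f n x - g x))" for n
  define a where "a n = enn2real (L2sq (f n))" for n
  define \<alpha> where "\<alpha> = enn2real (L2sq g)"
  have \<alpha>: "L2sq g = ennreal \<alpha>" "0 \<le> \<alpha>" using g by (auto simp: \<alpha>_def)
  have fin: "eventually (\<lambda>n. L2sq (\<lambda>x. f n x - g x) < \<top>) F"
    by (rule order_tendstoD(2)[OF lim]) simp
  have d0: "0 \<le> d n" "0 \<le> a n" for n by (auto simp: d_def a_def)
  have d: "(d \<longlongrightarrow> 0) F"
    unfolding d_def using tendsto_enn2real[OF lim[folded ennreal_0] order_refl] by simp
  have bounds: "eventually (\<lambda>n. L2sq (f n) = ennreal (a n) \<and>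
      (\<forall>\<delta>>0. \<bar>a n - \<alpha>\<bar> \<le> \<delta> * \<alpha> + (1 + 1 / \<delta>) * d n)) F"
    using fin
  proof eventually_elim
    case (elim n)
    have dn: "L2sq (\<lambda>x. f n x - g x) = ennreal (d n)" using elim by (auto simp: d_def)
    have dn': "L2sq (\<lambda>x. g x - f n x) = ennreal (d n)"
      using dn by (simp add: L2sq_def norm_minus_commute)
    have up: "L2sq (f n) \<le> ennreal (\<alpha> + \<delta> * \<alpha> + (1 + 1 / \<delta>) * d n)" if "\<delta> > 0" for \<delta>
      using L2sq_le_delta[of "f n" g g \<delta>] that \<alpha> d0[of n] unfolding dn
      by (simp add: ennreal_mult[symmetric] flip: ennreal_plus)
    have fn: "L2sq (f n) = ennreal (a n)"
      using up[of 1] unfolding a_def by (metis ennreal_enn2real_if ennreal_neq_top neq_top_trans zero_less_one)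
    have lo: "ennreal \<alpha> \<le> ennreal (a n + \<delta> * \<alpha> + (1 + 1 / \<delta>) * d n)" if "\<delta> > 0" for \<delta>
      using L2sq_le_delta[of g "f n" g \<delta>] that \<alpha> d0[of n] unfolding dn' fn
      by (simp add: ennreal_mult[symmetric] flip: ennreal_plus)
    have "\<bar>a n - \<alpha>\<bar> \<le> \<delta> * \<alpha> + (1 + 1 / \<delta>) * d n" if "\<delta> > 0" for \<delta>
      using up[OF that] lo[OF that] d0[of n] \<alpha>(2) that unfolding fn
      by (subst (asm) (1 2) ennreal_le_iff) (auto intro!: add_nonneg_nonneg)
    with fn show ?case by blast
  qed
  have "(a \<longlongrightarrow> \<alpha>) F"
  proof (rule tendstoI)
    fix e :: real assume e: "e > 0"
    \<comment> \<open>Makes \<open>\<delta> * \<alpha>\<close> at most e/2; the added 1 covers the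
      case \<alpha> = 0.\<close>
    define \<delta> where "\<delta> = e / (2 * (\<alpha> + 1))"
    have \<delta>: "\<delta> > 0" using e \<alpha> by (auto simp: \<delta>_def)
    have \<delta>\<alpha>: "\<delta> * \<alpha> \<le> e / 2"
      using e \<alpha> by (auto simp: \<delta>_def field_simps)
    have "eventually (\<lambda>n. (1 + 1 / \<delta>) * d n < e / 2) F"
      using tendsto_mult_right_zero[OF d, of "1 + 1 / \<delta>"] e by (intro order_tendstoD(2)) auto
    with bounds show "eventually (\<lambda>n. dist (a n) \<alpha> < e) F"
    proof eventually_elim
      case (elim n)
      then have "\<bar>a n - \<alpha>\<bar> \<le> \<delta> * \<alpha> + (1 + 1 / \<delta>) * d n" using \<delta> by blast
      then show ?case using elim \<delta>\<alpha> unfolding dist_real_def by linarith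
    qed
  qed
  then have "((\<lambda>n. ennreal (a n)) \<longlongrightarrow> ennreal \<alpha>) F" by (rule tendsto_ennrealI)
  then show ?thesis
    unfolding \<alpha>(1) by (rule Lim_transform_eventually) (use bounds in \<open>auto elim: eventually_mono\<close>)
qed

text \<open>Bessel applied to differences carries L2 convergence over to the transforms, so both
  sides pass to the limit. It is used twice, to go from continuous to bounded and from bounded to
  square integrable functions.\<close>

lemma Plancherel_limit:
  assumes fn: "\<And>n. integrable lborel (f n)" and f: "integrable lborel g" and fin: "L2sq g < \<top>"
    and lim: "(\<lambda>n. L2sq (\<lambda>x. f n x - g x)) \<longlonglongrightarrow> 0"
    and P: "\<And>n. L2sq (FT s (f n)) = L2sq (f n)" and s: "s\<^sup>2 = 1"
  shows "L2sq (FT s g) = L2sq g"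
proof -
  have [measurable]: "f n \<in> borel_measurable borel" "g \<in> borel_measurable borel" for n
    using fn[of n] f by auto
  have "L2sq (\<lambda>x. FT s (f n) x - FT s g x) \<le> L2sq (\<lambda>x. f n x - g x)" for n
    unfolding FT_diff[OF fn f, symmetric] using fn f by (intro Bessel_FT s) auto
  then have "(\<lambda>n. L2sq (\<lambda>x. FT s (f n) x - FT s g x)) \<longlonglongrightarrow> 0"
    by (intro tendsto_sandwich[OF _ _ tendsto_const lim]) auto
  moreover have "L2sq (FT s g) < \<top>"
    using Bessel_FT[OF f s] fin by simp
  ultimately have "(\<lambda>n. L2sq (FT s (f n))) \<longlonglongrightarrow> L2sq (FT s g)"
    by (intro L2sq_tendsto) auto
  moreover have "(\<lambda>n. L2sq (f n)) \<longlonglongrightarrow> L2sq g"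
    using fin lim by (intro L2sq_tendsto) auto
  ultimately show ?thesis unfolding P by (rule LIMSEQ_unique)
qed

lemma L2sq_tendsto_dominated:
  assumes [measurable]: "\<And>n. f n \<in> borel_measurable borel" "g \<in> borel_measurable borel"
      "w \<in> borel_measurable borel"
    and w: "\<And>n. AE x in lborel. (cmod (f n x - g x))\<^sup>2 \<le> w x" "integrable lborel w"
    and lim: "AE x in lborel. (\<lambda>n. f n x) \<longlonglongrightarrow> g x"
  shows "(\<lambda>n. L2sq (\<lambda>x. f n x - g x)) \<longlonglongrightarrow> 0"
proof -
  have "(\<lambda>n. \<integral>\<^sup>+x. ennreal ((cmod (f n x - g x))\<^sup>2) \<partial>lborel) \<longlonglongrightarrow> (\<integral>\<^sup>+(x::real). 0 \<partial>lborel)"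
  proof (rule nn_integral_dominated_convergence[where w = "\<lambda>x. ennreal (norm (w x))"])
    show "AE x in lborel. ennreal ((cmod (f n x - g x))\<^sup>2) \<le> ennreal (norm (w x))" for n
      using w(1)[of n] by eventually_elim (auto intro: ennreal_leI)
    show "(\<integral>\<^sup>+x. ennreal (norm (w x)) \<partial>lborel) < \<infinity>"
      using w(2) by (simp add: integrable_iff_bounded)
    show "AE x in lborel. (\<lambda>n. ennreal ((cmod (f n x - g x))\<^sup>2)) \<longlonglongrightarrow> 0"
      using lim
    proof eventually_elim
      case (elim x)
      then have "(\<lambda>n. (cmod (f n x - g x))\<^sup>2) \<longlonglongrightarrow> (cmod (g x - g x))\<^sup>2"
        by (intro tendsto_intros)
      then show ?case by (intro tendsto_ennrealI[of _ 0, simplified]) simp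
    qed
  qed measurable
  then show ?thesis by (simp add: L2sq_def)
qed

section \<open>Plancherel for functions of bounded support\<close>

lemma integrable_indicator_Icc:
  fixes a b :: real
  shows "integrable lborel (\<lambda>x. c * indicat_real {a..b} x)"
  by (intro integrable_mult_right integrable_real_indicator) (auto simp: emeasure_lborel_Icc_eq)

lemma integrable_bounded_support:
  fixes f :: "real \<Rightarrow> 'b::{banach, second_countable_topology}"
  assumes [measurable]: "f \<in> borel_measurable borel" and B: "\<And>x. norm (f x) \<le> B"
    and supp: "\<And>x. x \<notin> {-R..R} \<Longrightarrow> f x = 0"
  shows "integrable lborel f"
proof (rule Bochner_Integration.integrable_bound)
  show "integrable lborel (\<lambda>x. B * indicator {-R..R} x)"
    by (rule integrable_indicator_Icc)
  show "AE x in lborel. norm (f x) \<le> norm (B * indicator {-R..R} x)"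
    using B supp abs_ge_self order_trans by (auto simp: indicator_def) fastforce+
qed simp

lemma Plancherel_bounded_support:
  assumes [measurable]: "f \<in> borel_measurable borel" and B: "\<And>x. cmod (f x) \<le> B"
    and supp: "\<And>x. x \<notin> {-R..R} \<Longrightarrow> f x = 0" and s: "s\<^sup>2 = 1"
  shows "L2sq (FT s f) = L2sq f"
proof -
  have f: "integrable lborel f" using B supp by (rule integrable_bounded_support[rotated]) auto
  \<comment> \<open>The maximum with 1 keeps the denominators below positive.\<close>
  define C where "C = max B 1"
  have C: "C > 0" "\<And>x. cmod (f x) \<le> C" using B by (auto simp: C_def intro: max.coboundedI1)
  have "f measurable_on UNIV"
    by (rule lebesgue_measurable_imp_measurable_on) (auto intro!: measurable_completion)
  then obtain N g where N: "negligible N" and g: "\<And>n. continuous_on UNIV (g n)"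
    and lim: "\<And>x. x \<notin> N \<Longrightarrow> (\<lambda>n. g n x) \<longlonglongrightarrow> f x"
    unfolding measurable_on_def by auto
  \<comment> \<open>The continuous approximants \<open>g n\<close> need be neither bounded nor
    compactly supported. The tent \<open>cut\<close> repairs the support and the factor
    \<open>C / max C (cmod (g n x))\<close> retracts the values to the disc of radius
    \<open>C\<close>. Both act as the identity on \<open>f\<close>, so the limit is
    unchanged.\<close>
  define cut where "cut x = max 0 (min 1 (R + 1 - \<bar>x\<bar>))" for x
  define h where "h n x = complex_of_real (cut x * (C / max C (cmod (g n x)))) * g n x" for n x
  have cont: "continuous_on UNIV (h n)" for n
    unfolding h_def cut_def using C by (intro continuous_intros g) (auto simp: max_def)
  have [measurable]: "h n \<in> borel_measurable borel" for n
    using cont by (intro borel_measurable_continuous_onI)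
  have cut: "0 \<le> cut x" "cut x \<le> 1" "x \<notin> {-(R+1)..R+1} \<Longrightarrow> cut x = 0" "x \<in> {-R..R} \<Longrightarrow> cut x = 1" for x
    by (auto simp: cut_def)
  have hC: "cmod (h n x) \<le> C" for n x
  proof -
    have "C / max C (cmod (g n x)) * cmod (g n x) \<le> C"
      using C by (auto simp: max_def field_simps)
    then have "cut x * (C / max C (cmod (g n x)) * cmod (g n x)) \<le> 1 * C"
      using cut[of x] C by (intro mult_mono) auto
    then show ?thesis using cut(1)[of x] C(1) by (simp add: h_def norm_mult norm_divide abs_mult)
  qed
  have hsupp: "h n x = 0" if "x \<notin> {-(R+1)..R+1}" for n x
    using cut(3)[OF that] by (simp add: h_def)
  have hlim: "(\<lambda>n. h n x) \<longlonglongrightarrow> f x" if "x \<notin> N" for x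
  proof -
    have "(\<lambda>n. h n x) \<longlonglongrightarrow> complex_of_real (cut x * (C / max C (cmod (f x)))) * f x"
      unfolding h_def using C by (intro tendsto_intros lim that) (auto simp: max_def)
    moreover have "complex_of_real (cut x * (C / max C (cmod (f x)))) * f x = f x"
      using C cut(4)[of x] supp[of x] by (cases "x \<in> {-R..R}") (auto simp: max_absorb1)
    ultimately show ?thesis by simp
  qed
  have hint: "integrable lborel (h n)" for n
    using hC hsupp by (rule integrable_bounded_support[rotated]) auto
  have "AE x in lborel. x \<notin> N"
    using N by (auto simp: negligible_iff_null_sets null_sets_completion_iff2 intro: AE_I' elim!: AE_mp[OF AE_not_in])
  then have ae: "AE x in lborel. (\<lambda>n. h n x) \<longlonglongrightarrow> f x"
    by eventually_elim (rule hlim)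
  have conv: "(\<lambda>n. L2sq (\<lambda>x. h n x - f x)) \<longlonglongrightarrow> 0"
  proof (rule L2sq_tendsto_dominated[where w = "\<lambda>x. (2 * C)\<^sup>2 * indicator {-(R+1)..R+1} x"])
    show "integrable lborel (\<lambda>x. (2 * C)\<^sup>2 * indicator {-(R+1)..R+1} x)"
      by (rule integrable_indicator_Icc)
    have "(cmod (h n x - f x))\<^sup>2 \<le> (2 * C)\<^sup>2 * indicator {-(R+1)..R+1} x" for n x
    proof (cases "x \<in> {-(R+1)..R+1}")
      case True
      have "cmod (h n x - f x) \<le> 2 * C"
        using norm_triangle_ineq4[of "h n x" "f x"] hC[of n x] C(2)[of x] by simp
      then have "(cmod (h n x - f x))\<^sup>2 \<le> (2 * C)\<^sup>2" by (intro power_mono) auto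
      then show ?thesis using True by simp
    next
      case False
      then show ?thesis using hsupp[of x n] supp[of x] by auto
    qed
    then show "AE x in lborel. (cmod (h n x - f x))\<^sup>2 \<le> (2 * C)\<^sup>2 * indicator {-(R+1)..R+1} x" for n
      by simp
  qed (use ae in auto)
  have fin: "L2sq f < \<top>"
  proof -
    have "integrable lborel (\<lambda>x. (cmod (f x))\<^sup>2)"
      by (rule integrable_bounded_support[where B = "C\<^sup>2" and R = R]) (use C supp in \<open>auto intro: power_mono\<close>)
    then show ?thesis by (simp add: L2sq_less_top_iff)
  qed
  show ?thesis
    by (rule Plancherel_limit[OF hint f fin conv Plancherel_continuous[OF cont hC hint s] s])
qed

lemma integrable_of_L2_support:
  assumes [measurable]: "f \<in> borel_measurable borel" and L2: "L2sq f < \<top>"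
    and supp: "\<And>x. x \<notin> {-R..R} \<Longrightarrow> f x = 0"
  shows "integrable lborel f"
proof (rule Bochner_Integration.integrable_bound)
  show "integrable lborel (\<lambda>x. indicator {-R..R} x + (cmod (f x))\<^sup>2)"
    using L2 integrable_indicator_Icc[of 1] by (intro Bochner_Integration.integrable_add) (auto simp: L2sq_less_top_iff)
  have "cmod (f x) \<le> indicator {-R..R} x + (cmod (f x))\<^sup>2" for x
  proof (cases "x \<in> {-R..R}")
    case True
    have "2 * 1 * cmod (f x) \<le> 1\<^sup>2 + (cmod (f x))\<^sup>2" by (rule sum_squares_bound)
    then have "cmod (f x) \<le> 1 + (cmod (f x))\<^sup>2" using norm_ge_zero[of "f x"] unfolding one_power2 by linarith
    then show ?thesis using True by simp
  qed (auto simp: supp)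
  then show "AE x in lborel. norm (f x) \<le> norm (indicator {-R..R} x + (cmod (f x))\<^sup>2)"
    by auto
qed simp

text \<open>Discarding the values above height n leaves bounded functions whose distance to
  \<open>f\<close> is dominated by \<open>f\<close> itself.\<close>

theorem Plancherel_support:
  assumes [measurable]: "f \<in> borel_measurable borel" and L2: "L2sq f < \<top>"
    and supp: "\<And>x. x \<notin> {-R..R} \<Longrightarrow> f x = 0" and s: "s\<^sup>2 = 1"
  shows "L2sq (FT s f) = L2sq f"
proof -
  have f: "integrable lborel f" by (rule integrable_of_L2_support[OF _ L2 supp]) auto
  define h where "h n x = (if cmod (f x) \<le> real n then f x else 0)" for n x
  have [measurable]: "h n \<in> borel_measurable borel" for n unfolding h_def[abs_def] by measurable
  have hB: "cmod (h n x) \<le> real n" for n x by (auto simp: h_def)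
  have hsupp: "h n x = 0" if "x \<notin> {-R..R}" for n x using supp[OF that] by (auto simp: h_def)
  have hint: "integrable lborel (h n)" for n
    by (rule integrable_bounded_support[OF _ hB hsupp]) auto
  have conv: "(\<lambda>n. L2sq (\<lambda>x. h n x - f x)) \<longlonglongrightarrow> 0"
  proof (rule L2sq_tendsto_dominated[where w = "\<lambda>x. (cmod (f x))\<^sup>2"])
    have "(\<lambda>n. h n x) \<longlonglongrightarrow> f x" for x
    proof (rule tendsto_eventually)
      obtain k where "cmod (f x) \<le> real k" using real_arch_simple by blast
      then show "eventually (\<lambda>n. h n x = f x) sequentially"
        by (auto simp: h_def eventually_sequentially intro!: exI[of _ k])
    qed
    then show "AE x in lborel. (\<lambda>n. h n x) \<longlonglongrightarrow> f x" by simp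
  qed (use L2 in \<open>auto simp: L2sq_less_top_iff h_def\<close>)
  have P: "L2sq (FT s (h n)) = L2sq (h n)" for n
    by (rule Plancherel_bounded_support[OF _ hB hsupp s]) auto
  show ?thesis by (rule Plancherel_limit[OF hint f L2 conv P s])
qed

text \<open>Plancherel for \<open>f\<close> and Bessel for \<open>w\<close> suffice, the cross terms being equal by the
  multiplication formula.\<close>
lemma L2sq_diff_FT_le:
  assumes [measurable]: "f \<in> borel_measurable borel" "w \<in> borel_measurable borel"
    and f2: "L2sq f < \<top>" and w2: "L2sq w < \<top>"
    and fs: "\<And>x. x \<notin> {-R..R} \<Longrightarrow> f x = 0" and ws: "\<And>x. x \<notin> {-S..S} \<Longrightarrow> w x = 0" and s: "s\<^sup>2 = 1"
  shows "L2sq (\<lambda>x. f x - FT s w x) \<le> L2sq (\<lambda>x. FT (-s) f x - w x)"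
proof -
  have s': "(-s)\<^sup>2 = 1" using s by simp
  have f: "integrable lborel f" by (rule integrable_of_L2_support[OF _ f2 fs]) auto
  have w: "integrable lborel w" by (rule integrable_of_L2_support[OF _ w2 ws]) auto
  have Pf: "L2sq (FT (-s) f) = L2sq f" by (rule Plancherel_support[OF _ f2 fs s']) auto
  have Bw: "L2sq (FT s w) \<le> L2sq w" by (rule Bessel_FT[OF w s])
  have expand: "L2sq (\<lambda>x. a x - b x) = ennreal ((LINT x|lborel. (cmod (a x))\<^sup>2) + (LINT x|lborel. (cmod (b x))\<^sup>2)
      - 2 * Re (LINT x|lborel. a x * cnj (b x)))"
    if [measurable]: "a \<in> borel_measurable borel" "b \<in> borel_measurable borel"
      and a: "L2sq a < \<top>" and b: "L2sq b < \<top>" for a b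
  proof -
    have a2: "integrable lborel (\<lambda>x. (cmod (a x))\<^sup>2)" and b2: "integrable lborel (\<lambda>x. (cmod (b x))\<^sup>2)"
      using a b by (auto simp: L2sq_less_top_iff)
    have ab: "integrable lborel (\<lambda>x. a x * cnj (b x))"
    proof (rule Bochner_Integration.integrable_bound)
      show "integrable lborel (\<lambda>x. (cmod (a x))\<^sup>2 + (cmod (b x))\<^sup>2)" using a2 b2 by simp
      have "cmod (a x) * cmod (b x) \<le> (cmod (a x))\<^sup>2 + (cmod (b x))\<^sup>2" for x
        using sum_squares_bound[of "cmod (a x)" "cmod (b x)"]
          mult_nonneg_nonneg[OF norm_ge_zero[of "a x"] norm_ge_zero[of "b x"]] by linarith
      then show "AE x in lborel. norm (a x * cnj (b x)) \<le> norm ((cmod (a x))\<^sup>2 + (cmod (b x))\<^sup>2)"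
        by (auto simp: norm_mult)
    qed measurable
    define r where "r x = Re (a x * cnj (b x))" for x
    have r: "integrable lborel r" unfolding r_def[abs_def] by (rule integrable_Re[OF ab])
    have eq: "(cmod (a x - b x))\<^sup>2 = (cmod (a x))\<^sup>2 + (cmod (b x))\<^sup>2 - 2 * r x" for x
      unfolding cmod_power2 r_def by (simp add: power2_eq_square algebra_simps)
    have "integrable lborel (\<lambda>x. (cmod (a x - b x))\<^sup>2)"
      unfolding eq using a2 b2 r by simp
    then have "L2sq (\<lambda>x. a x - b x) = ennreal (LINT x|lborel. (cmod (a x - b x))\<^sup>2)"
      by (rule L2sq_eq_integral)
    also have "(LINT x|lborel. (cmod (a x - b x))\<^sup>2) = (LINT x|lborel. (cmod (a x))\<^sup>2) + (LINT x|lborel. (cmod (b x))\<^sup>2)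
      - 2 * (LINT x|lborel. r x)"
      unfolding eq using a2 b2 r by simp
    also have "(LINT x|lborel. r x) = Re (LINT x|lborel. a x * cnj (b x))"
      unfolding r_def using ab by (rule integral_Re)
    finally show ?thesis .
  qed
  have cross: "(LINT x|lborel. f x * cnj (FT s w x)) = (LINT x|lborel. FT (-s) f x * cnj (w x))"
    unfolding cnj_FT by (rule FT_mult_formula) (use f w in auto)
  have int: "L2sq a < \<top> \<Longrightarrow> a \<in> borel_measurable borel \<Longrightarrow> L2sq a = ennreal (LINT x|lborel. (cmod (a x))\<^sup>2)" for a
    by (rule L2sq_eq_integral) (simp add: L2sq_less_top_iff)
  have Ff2: "L2sq (FT (-s) f) < \<top>" using Pf f2 by simp
  have Fw2: "L2sq (FT s w) < \<top>" using Bw w2 by (rule le_less_trans)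
  have "(LINT x|lborel. (cmod (FT (-s) f x))\<^sup>2) = (LINT x|lborel. (cmod (f x))\<^sup>2)"
    using Pf int[OF f2] int[OF Ff2] by simp
  moreover have "(LINT x|lborel. (cmod (FT s w x))\<^sup>2) \<le> (LINT x|lborel. (cmod (w x))\<^sup>2)"
    using Bw int[OF w2] int[OF Fw2] by simp
  ultimately show ?thesis
    using f2 w2 Ff2 Fw2 by (simp add: expand cross ennreal_leI)
qed

section \<open>A discrete Moser-Adams inequality\<close>

definition residual :: "(nat \<Rightarrow> real) \<Rightarrow> nat \<Rightarrow> real" where
  "residual g k = sqrt (1 - (\<Sum>j<k. (g j)\<^sup>2))"

text \<open>Adams' function k - F(k)^2, where F is sqrt \<open>pi\<close> times the rearrangement
  bound at e^(-k), with the sqrt \<open>pi\<close> in front of the residual rounded up to 2. The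
  critical integral will be a sum of terms exp(-deficit).\<close>

definition deficit :: "(nat \<Rightarrow> real) \<Rightarrow> nat \<Rightarrow> real" where
  "deficit g k = real k - ((\<Sum>j<k. g j) + 2 * residual g k)\<^sup>2"

context
  fixes g :: "nat \<Rightarrow> real"
  assumes g0: "\<And>k. 0 \<le> g k" and g1: "\<And>k. (\<Sum>j<k. (g j)\<^sup>2) \<le> 1"
begin

lemma residual_nonneg: "0 \<le> residual g k" and residual_le_1: "residual g k \<le> 1" and residual_sq: "(residual g k)\<^sup>2 = 1 - (\<Sum>j<k. (g j)\<^sup>2)"
  using g1[of k] by (auto simp: residual_def sum_nonneg)

lemma residual_antimono: "k \<le> l \<Longrightarrow> residual g l \<le> residual g k"
  unfolding residual_def by (intro real_sqrt_le_mono diff_left_mono sum_mono2) auto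

text \<open>Cauchy-Schwarz on the block alone: growth after \<open>k\<close> is paid for by the
  energy left at \<open>k\<close>.\<close>

lemma partial_sum_le:
  assumes "k \<le> l"
  shows "(\<Sum>j=k..<l. g j) \<le> sqrt (real (l - k)) * residual g k"
proof -
  have "(\<Sum>j=k..<l. g j * 1)\<^sup>2 \<le> (\<Sum>j=k..<l. (g j)\<^sup>2) * (\<Sum>j=k..<l. 1\<^sup>2)"
    by (rule Cauchy_Schwarz_ineq_sum)
  moreover have "(\<Sum>j=k..<l. (g j)\<^sup>2) \<le> (residual g k)\<^sup>2"
  proof -
    have "(\<Sum>j<l. (g j)\<^sup>2) = (\<Sum>j<k. (g j)\<^sup>2) + (\<Sum>j=k..<l. (g j)\<^sup>2)"
      using assms by (simp add: sum.atLeastLessThan_concat lessThan_atLeast0)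
    then show ?thesis using g1[of l] residual_sq[of k] by simp
  qed
  ultimately have "(\<Sum>j=k..<l. g j)\<^sup>2 \<le> (residual g k)\<^sup>2 * real (l - k)"
    by (smt (verit) mult.right_neutral mult_right_mono of_nat_0_le_iff one_power2 real_of_card card_atLeastLessThan sum.cong)
  also have "\<dots> = (sqrt (real (l - k)) * residual g k)\<^sup>2" by (simp add: power_mult_distrib)
  finally show ?thesis by (rule power2_le_imp_le) (simp add: residual_nonneg)
qed

lemma initial_sum_sq_le: "(\<Sum>j<k. g j)\<^sup>2 \<le> real k * (1 - (residual g k)\<^sup>2)"
proof -
  have "(\<Sum>j<k. g j * 1)\<^sup>2 \<le> (\<Sum>j<k. (g j)\<^sup>2) * (\<Sum>j<k. 1\<^sup>2)"
    by (rule Cauchy_Schwarz_ineq_sum)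
  then show ?thesis by (simp add: residual_sq mult.commute)
qed

lemma deficit_ge: "-4 \<le> deficit g k"
proof -
  define S where "S = (\<Sum>j<k. g j)"
  define L where "L = residual g k"
  have L: "0 \<le> L" "L \<le> 1" using residual_nonneg residual_le_1 by (auto simp: L_def)
  have S: "S\<^sup>2 \<le> real k * (1 - L\<^sup>2)" unfolding S_def L_def by (rule initial_sum_sq_le)
  \<comment> \<open>Cauchy-Schwarz for \<open>(\<surd>k, 2)\<close> and \<open>(\<surd>(1 - L\<^sup>2), L)\<close>\<close>
  define q where "q = sqrt (1 - L\<^sup>2)"
  have q: "q\<^sup>2 = 1 - L\<^sup>2" "0 \<le> q" using L by (auto simp: q_def power_le_one)
  define r where "r = sqrt (real k)"
  have r: "r\<^sup>2 = real k" "0 \<le> r" by (auto simp: r_def)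
  have "S\<^sup>2 \<le> (r * q)\<^sup>2" using S by (simp add: power_mult_distrib r q)
  then have "S \<le> r * q" by (rule power2_le_imp_le) (simp add: r q)
  then have "(S + 2 * L)\<^sup>2 \<le> (r * q + 2 * L)\<^sup>2"
    using g0 L by (intro power_mono) (auto simp: S_def sum_nonneg)
  also have "\<dots> = (r\<^sup>2 + 4) * (q\<^sup>2 + L\<^sup>2) - (r * L - 2 * q)\<^sup>2" by algebra
  also have "\<dots> \<le> real k + 4" using q r by simp
  finally show ?thesis by (simp add: deficit_def S_def L_def)
qed

text \<open>A small deficit means near equality in Cauchy-Schwarz for the first \<open>k\<close>
  terms, so they have used almost all of the energy. As the deficit is never below -4, writing the
  level as \<open>\<mu> - 5\<close> with \<mu> \<ge> 1 covers all relevant levels.\<close>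

lemma residual_sq_le_of_deficit:
  assumes F: "deficit g k \<le> \<mu> - 5" and \<mu>: "1 \<le> \<mu>"
  shows "real k * (residual g k)\<^sup>2 \<le> 16 * \<mu>"
proof -
  define S where "S = (\<Sum>j<k. g j)"
  define L where "L = residual g k"
  define r where "r = sqrt (real k)"
  have r: "r\<^sup>2 = real k" "0 \<le> r" by (auto simp: r_def)
  have L: "0 \<le> L" "L \<le> 1" using residual_nonneg residual_le_1 by (auto simp: L_def)
  have S: "S\<^sup>2 \<le> real k * (1 - L\<^sup>2)" unfolding S_def L_def by (rule initial_sum_sq_le)
  have Sr: "S \<le> r"
  proof (rule power2_le_imp_le)
    have "real k * (1 - L\<^sup>2) \<le> real k * 1" by (intro mult_left_mono) auto
    then show "S\<^sup>2 \<le> r\<^sup>2" using S r by simp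
  qed (rule r)
  define y where "y = r * L"
  have y: "0 \<le> y" using r L by (simp add: y_def)
  have "real k - (S + 2 * L)\<^sup>2 \<le> \<mu> - 5" using F by (simp add: deficit_def S_def L_def)
  moreover have "(S + 2 * L)\<^sup>2 = S\<^sup>2 + 4 * (S * L) + 4 * L\<^sup>2" by (simp add: power2_eq_square algebra_simps)
  moreover have "S * L \<le> y" unfolding y_def using Sr L by (intro mult_right_mono) auto
  moreover have "L\<^sup>2 \<le> 1" using L by (simp add: power_le_one)
  moreover have y2: "y\<^sup>2 = real k * L\<^sup>2" by (simp add: y_def power_mult_distrib r)
  ultimately have "y\<^sup>2 \<le> \<mu> - 5 + 4 * y + 4" using S by (simp add: right_diff_distrib)
  \<comment> \<open>Gives 4y \<le> y^2/2 + 8, which absorbs the linear term: y^2 \<le> 2 \<mu> + 14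
    \<le> 16 \<mu>.\<close>
  moreover have "0 \<le> (y - 4)\<^sup>2" by simp
  ultimately have "y\<^sup>2 \<le> 16 * \<mu>" using \<mu> by (simp add: power2_eq_square algebra_simps)
  then show ?thesis by (simp add: y2 L_def)
qed

text \<open>Two distant indices cannot both have a small deficit. At \<open>k\<close> little energy
  is left, so up to \<open>l\<close> the squared sum grows by at most a fraction of l - k plus a
  multiple of sqrt (\<mu> (l - k)), whereas its target grows by l - k.\<close>

lemma gap_le_of_deficit:
  assumes kl: "k \<le> l" and Fk: "deficit g k \<le> \<mu> - 5" and Fl: "deficit g l \<le> \<mu> - 5"
    and \<mu>: "1 \<le> \<mu>" and k: "128 * \<mu> \<le> real k"
  shows "real (l - k) \<le> 164 * \<mu>"
proof -
  define L where "L = residual g k"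
  define r where "r = sqrt (real k)"
  define e where "e = sqrt (real (l - k))"
  define m where "m = sqrt \<mu>"
  have nn: "0 \<le> r" "0 \<le> e" "0 \<le> m" "0 \<le> L" "L \<le> 1" using \<mu> residual_nonneg residual_le_1 by (auto simp: r_def e_def m_def L_def)
  have sq: "r\<^sup>2 = real k" "e\<^sup>2 = real (l - k)" "m\<^sup>2 = \<mu>" using \<mu> by (auto simp: r_def e_def m_def)
  have m1: "1 \<le> m" using \<mu> by (simp add: m_def)
  have kL: "real k * L\<^sup>2 \<le> 16 * \<mu>" unfolding L_def by (rule residual_sq_le_of_deficit[OF Fk \<mu>])
  have "(r * L)\<^sup>2 \<le> (4 * m)\<^sup>2" using kL by (simp add: power_mult_distrib sq)
  then have rL: "r * L \<le> 4 * m" by (rule power2_le_imp_le) (use nn in simp)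
  \<comment> \<open>The threshold 128 \<mu> on \<open>k\<close> is chosen for this: since (e + 2)^2
    \<le> 2 e^2 + 8, the quadratic growth is at most e^2/4 + 1.\<close>
  have L8: "L\<^sup>2 \<le> 1 / 8"
  proof -
    have "128 * \<mu> * L\<^sup>2 \<le> real k * L\<^sup>2" using k by (intro mult_right_mono) auto
    then have "\<mu> * (128 * L\<^sup>2) \<le> \<mu> * 16" using kL by simp
    then show ?thesis using \<mu> by simp
  qed
  have "(\<Sum>j<k. g j) \<le> r"
  proof (rule power2_le_imp_le)
    have "real k * (1 - L\<^sup>2) \<le> real k * 1" by (intro mult_left_mono) auto
    then show "(\<Sum>j<k. g j)\<^sup>2 \<le> r\<^sup>2" using initial_sum_sq_le[of k] by (simp add: sq L_def)
  qed (rule nn)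
  moreover have "(\<Sum>j<l. g j) = (\<Sum>j<k. g j) + (\<Sum>j=k..<l. g j)"
    using kl by (simp add: sum.atLeastLessThan_concat lessThan_atLeast0)
  moreover have "(\<Sum>j=k..<l. g j) \<le> e * L" unfolding e_def L_def by (rule partial_sum_le[OF kl])
  moreover have "residual g l \<le> L" unfolding L_def by (rule residual_antimono[OF kl])
  ultimately have "(\<Sum>j<l. g j) + 2 * residual g l \<le> r + L * (e + 2)"
    by (simp add: algebra_simps)
  then have "((\<Sum>j<l. g j) + 2 * residual g l)\<^sup>2 \<le> (r + L * (e + 2))\<^sup>2"
    using g0 residual_nonneg by (intro power_mono) (auto intro!: add_nonneg_nonneg sum_nonneg)
  also have "\<dots> = r\<^sup>2 + 2 * ((r * L) * (e + 2)) + L\<^sup>2 * (e + 2)\<^sup>2"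
    by (simp add: power2_eq_square algebra_simps)
  also have "\<dots> \<le> r\<^sup>2 + 2 * ((4 * m) * (e + 2)) + 1 / 8 * (2 * e\<^sup>2 + 8)"
  proof -
    have "0 \<le> (e - 2)\<^sup>2" by simp
    then have "(e + 2)\<^sup>2 \<le> 2 * e\<^sup>2 + 8" by (simp add: power2_eq_square algebra_simps)
    then have "L\<^sup>2 * (e + 2)\<^sup>2 \<le> 1 / 8 * (2 * e\<^sup>2 + 8)" by (intro mult_mono L8) auto
    moreover have "(r * L) * (e + 2) \<le> (4 * m) * (e + 2)" using nn by (intro mult_right_mono rL) auto
    ultimately show ?thesis by linarith
  qed
  finally have "((\<Sum>j<l. g j) + 2 * residual g l)\<^sup>2 \<le> r\<^sup>2 + 2 * ((4 * m) * (e + 2)) + 1 / 8 * (2 * e\<^sup>2 + 8)" .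
  then have "real l \<le> \<mu> - 5 + r\<^sup>2 + 8 * m * e + 16 * m + e\<^sup>2 / 4 + 1"
    using Fl by (simp add: deficit_def algebra_simps)
  moreover have "real l = r\<^sup>2 + e\<^sup>2" using kl by (simp add: sq of_nat_diff)
  \<comment> \<open>With this second quarter of e^2, half of it remains on the left, bounded by a
    multiple of \<mu>.\<close>
  moreover have "8 * m * e \<le> e\<^sup>2 / 4 + 64 * m\<^sup>2"
    using zero_le_power2[of "e / 2 - 8 * m"] by (simp add: power2_eq_square algebra_simps)
  moreover have "m \<le> m\<^sup>2" using m1 by (simp add: self_le_power)
  ultimately have "e\<^sup>2 / 2 \<le> 82 * \<mu>" using \<mu> sq by linarith
  then show ?thesis by (simp add: sq)
qed

text \<open>Indices below 128 \<mu> are counted outright, and the others lie in a window of length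
  164 \<mu> after the first of them. Each count rounds up by at most 1, whence 294 = 128 + 164 +
  2.\<close>

lemma card_deficit_le:
  assumes \<mu>: "1 \<le> \<mu>"
  shows "real (card {k \<in> {..<n}. deficit g k \<le> \<mu> - 5}) \<le> 294 * \<mu>"
proof -
  let ?E = "{k \<in> {..<n}. deficit g k \<le> \<mu> - 5}"
  let ?A = "{k \<in> ?E. real k < 128 * \<mu>}" and ?B = "{k \<in> ?E. 128 * \<mu> \<le> real k}"
  have "?A \<subseteq> {..<nat \<lceil>128 * \<mu>\<rceil>}" by (auto simp: less_ceiling_iff zless_nat_eq_int_zless)
  then have "card ?A \<le> nat \<lceil>128 * \<mu>\<rceil>" using card_mono[of "{..<nat \<lceil>128 * \<mu>\<rceil>}" ?A] by simp
  then have A: "real (card ?A) \<le> 128 * \<mu> + 1" using \<mu> by linarith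
  have B: "real (card ?B) \<le> 164 * \<mu> + 1"
  proof (cases "?B = {}")
    case True
    then have "card ?B = 0" by (simp only: card.empty)
    then show ?thesis using \<mu> by linarith
  next
    case False
    define k where "k = Min ?B"
    have k: "k \<in> ?B" unfolding k_def using False by (intro Min_in) auto
    have kle: "k \<le> l" if "l \<in> ?B" for l unfolding k_def using that by (intro Min_le) auto
    have "?B \<subseteq> {k..k + nat \<lfloor>164 * \<mu>\<rfloor>}"
    proof
      fix l assume l: "l \<in> ?B"
      have "real (l - k) \<le> 164 * \<mu>" using kle[OF l] k l \<mu> by (intro gap_le_of_deficit) auto
      then have "l - k \<le> nat \<lfloor>164 * \<mu>\<rfloor>" by (rule le_nat_floor)
      then show "l \<in> {k..k + nat \<lfloor>164 * \<mu>\<rfloor>}" using kle[OF l] by auto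
    qed
    then have "card ?B \<le> card {k..k + nat \<lfloor>164 * \<mu>\<rfloor>}" by (intro card_mono) auto
    then have "card ?B \<le> nat \<lfloor>164 * \<mu>\<rfloor> + 1" by simp
    then show ?thesis using \<mu> by linarith
  qed
  have "?E \<subseteq> ?A \<union> ?B" by auto
  then have "card ?E \<le> card (?A \<union> ?B)" by (intro card_mono) auto
  also have "\<dots> \<le> card ?A + card ?B" by (rule card_Un_le)
  finally show ?thesis using A B \<mu> by linarith
qed

end

text \<open>Layer i holds at most 294 (i + 1) indices, each contributing at most e^5 e^(-i), relaxed
  to e^6 e^(-i).\<close>

definition moser_const :: real where
  "moser_const = (\<Sum>i. 294 * exp 6 * (real (Suc i) * exp (-1) ^ i))"

lemma summable_moser: "summable (\<lambda>i. 294 * exp 6 * (real (Suc i) * exp (-1::real) ^ i))"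
proof -
  \<comment> \<open>The coefficients \<open>diffs (\<lambda>_. 1)\<close> are i + 1: this is the
    differentiated geometric series inside its radius 1.\<close>
  have "summable (\<lambda>i. diffs (\<lambda>_. 1) i * exp (-1::real) ^ i)"
    by (rule termdiff_converges[where K = 1]) (auto intro: summable_geometric)
  then show ?thesis by (intro summable_mult) (simp add: diffs_def)
qed

text \<open>Moser's one-dimensional inequality, with Adams' tail term: the sets on which the deficit is at
  most \<open>\<lambda>\<close> grow linearly in \<open>\<lambda>\<close>, so the exponential sum is dominated by a layer-cake series.\<close>
lemma moser_sum_le:
  assumes g0: "\<And>k. 0 \<le> g k" and g1: "\<And>k. (\<Sum>j<k. (g j)\<^sup>2) \<le> 1"
  shows "(\<Sum>k<n. exp (- deficit g k)) \<le> moser_const"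
proof -
  \<comment> \<open>The layer index. The shift by 4 makes the argument of \<open>nat\<close>
    nonnegative, by the lower bound on the deficit.\<close>
  define j where "j k = nat \<lceil>deficit g k + 4\<rceil>" for k
  have jd: "deficit g k \<le> real (j k) - 4" "real (j k) \<le> deficit g k + 5" for k
    using deficit_ge[OF g0 g1, of k] unfolding j_def by linarith+
  define J where "J = Suc (Max (insert 0 (j ` {..<n})))"
  have jJ: "j k < J" if "k < n" for k
    using that by (auto simp: J_def less_Suc_eq_le intro!: Max_ge)
  have "(\<Sum>k<n. exp (- deficit g k)) \<le> (\<Sum>k<n. exp 5 * exp (-1) ^ j k)"
  proof (rule sum_mono)
    fix k
    have "exp (- deficit g k) \<le> exp (5 - real (j k))" using jd(2)[of k] by simp
    also have "\<dots> = exp 5 * exp (-1) ^ j k" by (simp add: exp_diff exp_minus power_inverse divide_inverse flip: exp_of_nat_mult)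
    finally show "exp (- deficit g k) \<le> exp 5 * exp (-1) ^ j k" .
  qed
  also have "\<dots> = (\<Sum>k<n. \<Sum>i<J. if j k = i then exp 5 * exp (-1) ^ i else 0)"
    using jJ by (intro sum.cong refl) auto
  also have "\<dots> = (\<Sum>i<J. \<Sum>k<n. if j k = i then exp 5 * exp (-1) ^ i else 0)"
    by (rule sum.swap)
  also have "\<dots> \<le> (\<Sum>i<J. 294 * exp 6 * (real (Suc i) * exp (-1) ^ i))"
  proof (rule sum_mono)
    fix i
    \<comment> \<open>On layer i the deficit is at most i - 4 = (i + 1) - 5, so the counting bound
      applies with \<mu> = i + 1.\<close>
    have "{k \<in> {..<n}. j k = i} \<subseteq> {k \<in> {..<n}. deficit g k \<le> (real i + 1) - 5}"
      using jd(1) by force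
    then have "card {k \<in> {..<n}. j k = i} \<le> card {k \<in> {..<n}. deficit g k \<le> (real i + 1) - 5}"
      by (intro card_mono) auto
    also have "real \<dots> \<le> 294 * (real i + 1)" by (rule card_deficit_le[OF g0 g1]) auto
    finally have c: "real (card {k \<in> {..<n}. j k = i}) \<le> 294 * (real i + 1)" by simp
    have "(\<Sum>k<n. if j k = i then exp 5 * exp (-1) ^ i else 0) = real (card {k \<in> {..<n}. j k = i}) * (exp 5 * exp (-1) ^ i)"
      by (simp add: sum.If_cases Int_def)
    also have "\<dots> \<le> (294 * (real i + 1)) * (exp 6 * exp (-1) ^ i)"
      by (intro mult_mono c) auto
    finally show "(\<Sum>k<n. if j k = i then exp 5 * exp (-1) ^ i else 0) \<le> 294 * exp 6 * (real (Suc i) * exp (-1) ^ i)"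
      by (simp add: algebra_simps)
  qed
  also have "\<dots> \<le> moser_const"
    unfolding moser_const_def by (rule sum_le_suminf[OF summable_moser]) auto
  finally show ?thesis .
qed

section \<open>The critical inequality\<close>

lemma L2sq_diff_less_top:
  assumes [measurable]: "f \<in> borel_measurable borel" "g \<in> borel_measurable borel"
    and "L2sq f < \<top>" "L2sq g < \<top>"
  shows "L2sq (\<lambda>x. f x - g x) < \<top>"
proof -
  have "L2sq (\<lambda>x. f x - g x) \<le> L2sq f + ennreal 1 * L2sq f + ennreal (1 + 1 / 1) * L2sq (\<lambda>x. (f x - g x) - f x)"
    by (rule L2sq_le_delta) auto
  also have "L2sq (\<lambda>x. (f x - g x) - f x) = L2sq g" by (simp add: L2sq_def)
  also have "L2sq f + ennreal 1 * L2sq f + ennreal (1 + 1 / 1) * L2sq g < \<top>"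
    using assms by (simp add: ennreal_mult_less_top)
  finally show ?thesis .
qed

lemma L2_fourier_limits:
  assumes u: "memL2 u" and v: "is_L2_fourier u v"
  defines "un \<equiv> \<lambda>n x. indicator {-real n..real n} x *\<^sub>R complex_of_real (u x)"
  shows "(\<lambda>n. L2sq (\<lambda>x. un n x - complex_of_real (u x))) \<longlonglongrightarrow> 0"
    and "(\<lambda>n. L2sq (\<lambda>x. FT (-1) (un n) x - v x)) \<longlonglongrightarrow> 0"
proof -
  have [measurable]: "u \<in> borel_measurable borel" and u2: "integrable lborel (\<lambda>x. (u x)\<^sup>2)"
    using u by (auto simp: memL2_def)
  show "(\<lambda>n. L2sq (\<lambda>x. un n x - complex_of_real (u x))) \<longlonglongrightarrow> 0"
  proof (rule L2sq_tendsto_dominated[where w = "\<lambda>x. (u x)\<^sup>2"])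
    show "un n \<in> borel_measurable borel" for n unfolding un_def by measurable
    have "(\<lambda>n. un n x) \<longlonglongrightarrow> complex_of_real (u x)" for x
    proof (rule tendsto_eventually)
      obtain k where "\<bar>x\<bar> \<le> real k" using real_arch_simple by blast
      then have "un n x = complex_of_real (u x)" if "k \<le> n" for n
        using that by (auto simp: un_def indicator_def)
      then show "eventually (\<lambda>n. un n x = complex_of_real (u x)) sequentially"
        by (auto simp: eventually_sequentially)
    qed
    then show "AE x in lborel. (\<lambda>n. un n x) \<longlonglongrightarrow> complex_of_real (u x)" by simp
  qed (use u2 in \<open>auto simp: un_def indicator_def\<close>)
  have "((\<lambda>R. \<integral>\<^sup>+ \<xi>. ennreal ((cmod (v \<xi> - fourier_trunc u R \<xi>))\<^sup>2) \<partial>lborel) \<longlongrightarrow> 0) at_top"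
    using v by (simp add: is_L2_fourier_def)
  from filterlim_compose[OF this filterlim_real_sequentially]
  show "(\<lambda>n. L2sq (\<lambda>x. FT (-1) (un n) x - v x)) \<longlonglongrightarrow> 0"
    by (simp add: L2sq_def fourier_trunc_eq_FT un_def norm_minus_commute)
qed

text \<open>Both facts hold for the truncations of \<open>u\<close> and survive the limit. The
  second transfers approximation from the Fourier side: cutting \<open>v\<close> down to
  \<open>w\<close> costs \<open>u\<close> no more than it costs \<open>v\<close>.\<close>

lemma
  assumes u: "memL2 u" and v: "is_L2_fourier u v"
  shows L2sq_L2_fourier: "L2sq v = L2sq (\<lambda>x. complex_of_real (u x))"
    and L2sq_diff_inverse_FT_le: "w \<in> borel_measurable borel \<Longrightarrow> L2sq w < \<top> \<Longrightarrow> (\<And>x. x \<notin> {-S..S} \<Longrightarrow> w x = 0) \<Longrightarrow>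
      L2sq (\<lambda>x. complex_of_real (u x) - FT 1 w x) \<le> L2sq (\<lambda>x. v x - w x)"
proof -
  have [measurable]: "u \<in> borel_measurable borel" and u2: "integrable lborel (\<lambda>x. (u x)\<^sup>2)"
    using u by (auto simp: memL2_def)
  have [measurable]: "v \<in> borel_measurable borel" and v2: "integrable lborel (\<lambda>x. (cmod (v x))\<^sup>2)"
    using v by (auto simp: is_L2_fourier_def)
  let ?u = "\<lambda>x. complex_of_real (u x)"
  have Nu: "L2sq ?u < \<top>" using u2 by (simp add: L2sq_less_top_iff)
  have Nv: "L2sq v < \<top>" using v2 by (simp add: L2sq_less_top_iff)
  define un where "un n x = indicator {-real n..real n} x *\<^sub>R complex_of_real (u x)" for n x
  have [measurable]: "un n \<in> borel_measurable borel" for n unfolding un_def[abs_def] by measurable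
  note lims = L2_fourier_limits[OF u v, folded un_def]
  have un2: "L2sq (un n) < \<top>" for n
  proof -
    have "L2sq (un n) \<le> L2sq ?u"
      unfolding L2sq_def un_def by (intro nn_integral_mono) (auto simp: indicator_def)
    then show ?thesis using Nu by (rule le_less_trans)
  qed
  have uns: "un n x = 0" if "x \<notin> {-real n..real n}" for n x using that by (simp add: un_def)
  have "L2sq (FT (-1) (un n)) = L2sq (un n)" for n
    by (rule Plancherel_support[OF _ un2 uns]) auto
  moreover have "(\<lambda>n. L2sq (FT (-1) (un n))) \<longlonglongrightarrow> L2sq v"
    by (rule L2sq_tendsto[OF _ _ Nv lims(2)]) auto
  moreover have "(\<lambda>n. L2sq (un n)) \<longlonglongrightarrow> L2sq ?u"
    by (rule L2sq_tendsto[OF _ _ Nu lims(1)]) auto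
  ultimately show "L2sq v = L2sq ?u" by (simp add: LIMSEQ_unique)
  assume [measurable]: "w \<in> borel_measurable borel" and w2: "L2sq w < \<top>" and ws: "\<And>x. x \<notin> {-S..S} \<Longrightarrow> w x = 0"
  have wi: "integrable lborel w" by (rule integrable_of_L2_support[OF _ w2 ws]) auto
  have Fw2: "L2sq (FT 1 w) < \<top>" using Bessel_FT[OF wi, of 1] w2 by (auto elim: le_less_trans)
  have "(\<lambda>n. L2sq (\<lambda>x. un n x - FT 1 w x)) \<longlonglongrightarrow> L2sq (\<lambda>x. ?u x - FT 1 w x)"
  proof (rule L2sq_tendsto)
    show "L2sq (\<lambda>x. ?u x - FT 1 w x) < \<top>" using Nu Fw2 by (intro L2sq_diff_less_top) auto
    show "(\<lambda>n. L2sq (\<lambda>x. un n x - FT 1 w x - (?u x - FT 1 w x))) \<longlonglongrightarrow> 0" using lims(1) by simp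
  qed auto
  moreover have "(\<lambda>n. L2sq (\<lambda>x. FT (-1) (un n) x - w x)) \<longlonglongrightarrow> L2sq (\<lambda>x. v x - w x)"
  proof (rule L2sq_tendsto)
    show "L2sq (\<lambda>x. v x - w x) < \<top>" using Nv w2 by (intro L2sq_diff_less_top) auto
    show "(\<lambda>n. L2sq (\<lambda>x. FT (-1) (un n) x - w x - (v x - w x))) \<longlonglongrightarrow> 0" using lims(2) by simp
  qed auto
  moreover have "L2sq (\<lambda>x. un n x - FT 1 w x) \<le> L2sq (\<lambda>x. FT (-1) (un n) x - w x)" for n
    by (rule L2sq_diff_FT_le[OF _ _ un2 w2 uns ws]) auto
  ultimately show "L2sq (\<lambda>x. ?u x - FT 1 w x) \<le> L2sq (\<lambda>x. v x - w x)"
    by (intro LIMSEQ_le) auto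
qed

section \<open>Exponential frequency shells\<close>

definition low_freq :: "nat \<Rightarrow> real set" where
  "low_freq k = {\<xi>. 1 + \<bar>\<xi>\<bar> < exp (real k)}"

lemma low_freq_0 [simp]: "low_freq 0 = {}" and low_freq_mono: "k \<le> l \<Longrightarrow> low_freq k \<subseteq> low_freq l"
  and low_freq_borel [measurable]: "low_freq k \<in> sets borel"
  and low_freq_bounded: "low_freq k \<subseteq> {-exp (real k)..exp (real k)}"
proof -
  show "low_freq k \<subseteq> low_freq l" if "k \<le> l"
  proof -
    have "exp (real k) \<le> exp (real l)" using that by simp
    then show ?thesis unfolding low_freq_def using less_le_trans by blast
  qed
  show "low_freq k \<in> sets borel" unfolding low_freq_def by measurable
qed (auto simp: low_freq_def)

lemma nn_integral_shell_le:
  "(\<integral>\<^sup>+\<xi>. ennreal (1 / (1 + \<bar>\<xi>\<bar>)) * indicator (low_freq (Suc k) - low_freq k) \<xi> \<partial>lborel) \<le> 2"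
proof -
  define a where "a = exp (real k) - 1"
  define b where "b = exp (real (Suc k)) - 1"
  have ab: "0 \<le> a" "a \<le> b" by (auto simp: a_def b_def)
  define f where "f x = ennreal (1 / (1 + \<bar>x\<bar>)) * indicator {a..b} x" for x :: real
  have [measurable]: "f \<in> borel_measurable borel" unfolding f_def[abs_def] by measurable
  have "(\<integral>\<^sup>+x. f x \<partial>lborel) = (\<integral>\<^sup>+x. ennreal (1 / (1 + x)) * indicator {a..b} x \<partial>lborel)"
    using ab by (intro nn_integral_cong) (auto simp: f_def indicator_def)
  also have "\<dots> = ennreal (ln (1 + b) - ln (1 + a))"
    using ab by (intro nn_integral_FTC_Icc) (auto intro!: derivative_eq_intros)
  also have "ln (1 + b) - ln (1 + a) = 1" by (simp add: a_def b_def)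
  finally have f1: "(\<integral>\<^sup>+x. f x \<partial>lborel) = 1" by simp
  then have f2: "(\<integral>\<^sup>+x. f (0 + - 1 * x) \<partial>lborel) = 1"
    by (subst (asm) nn_integral_real_affine[of f "-1" 0]) auto
  have "(\<integral>\<^sup>+\<xi>. ennreal (1 / (1 + \<bar>\<xi>\<bar>)) * indicator (low_freq (Suc k) - low_freq k) \<xi> \<partial>lborel) \<le> (\<integral>\<^sup>+x. f x + f (0 + - 1 * x) \<partial>lborel)"
    by (intro nn_integral_mono) (auto simp: f_def a_def b_def low_freq_def indicator_def abs_if)
  also have "\<dots> = (\<integral>\<^sup>+x. f x \<partial>lborel) + (\<integral>\<^sup>+x. f (0 + - 1 * x) \<partial>lborel)"
    by (rule nn_integral_add) measurable
  also have "\<dots> = 2" unfolding f1 f2 by simp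
  finally show ?thesis .
qed

lemma shell_Cauchy_Schwarz:
  assumes [measurable]: "v \<in> borel_measurable borel"
    and E: "integrable lborel (\<lambda>\<xi>. (1 + \<bar>\<xi>\<bar>) * (cmod (v \<xi>))\<^sup>2)"
  shows "integrable lborel (\<lambda>\<xi>. indicator (low_freq (Suc k) - low_freq k) \<xi> * cmod (v \<xi>))" (is ?I)
    and "(LINT \<xi>|lborel. indicator (low_freq (Suc k) - low_freq k) \<xi> * cmod (v \<xi>))
      \<le> sqrt 2 * sqrt (LINT \<xi>|lborel. indicator (low_freq (Suc k) - low_freq k) \<xi> * ((1 + \<bar>\<xi>\<bar>) * (cmod (v \<xi>))\<^sup>2))" (is ?le)
proof -
  let ?A = "low_freq (Suc k) - low_freq k"
  define e where "e = (LINT \<xi>|lborel. indicator ?A \<xi> * ((1 + \<bar>\<xi>\<bar>) * (cmod (v \<xi>))\<^sup>2))"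
  have e0: "0 \<le> e" unfolding e_def by (intro integral_nonneg_AE) auto
  have Ei: "integrable lborel (\<lambda>\<xi>. indicator ?A \<xi> * ((1 + \<bar>\<xi>\<bar>) * (cmod (v \<xi>))\<^sup>2))"
    by (rule Bochner_Integration.integrable_bound[OF E]) (auto simp: indicator_def)
  define f where "f \<xi> = ennreal (indicator ?A \<xi> * (sqrt (1 + \<bar>\<xi>\<bar>) * cmod (v \<xi>)))" for \<xi>
  define g where "g \<xi> = ennreal (indicator ?A \<xi> / sqrt (1 + \<bar>\<xi>\<bar>))" for \<xi> :: real
  have [measurable]: "f \<in> borel_measurable borel" "g \<in> borel_measurable borel"
    unfolding f_def[abs_def] g_def[abs_def] by measurable
  have pos: "0 < 1 + \<bar>\<xi>\<bar>" for \<xi> :: real by simp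
  have fg: "f \<xi> * g \<xi> = ennreal (indicator ?A \<xi> * cmod (v \<xi>))" for \<xi>
    using pos[of \<xi>] by (auto simp: f_def g_def indicator_def ennreal_mult[symmetric])
  have "(\<integral>\<^sup>+\<xi>. f \<xi> * g \<xi> \<partial>lborel)\<^sup>2 \<le> (\<integral>\<^sup>+\<xi>. f \<xi> ^ 2 \<partial>lborel) * (\<integral>\<^sup>+\<xi>. g \<xi> ^ 2 \<partial>lborel)"
    by (rule Cauchy_Schwarz_nn_integral) measurable
  also have "(\<integral>\<^sup>+\<xi>. f \<xi> ^ 2 \<partial>lborel) = (\<integral>\<^sup>+\<xi>. ennreal (indicator ?A \<xi> * ((1 + \<bar>\<xi>\<bar>) * (cmod (v \<xi>))\<^sup>2)) \<partial>lborel)"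
    by (intro nn_integral_cong) (auto simp: f_def indicator_def ennreal_power power_mult_distrib)
  also have "\<dots> = ennreal e"
    unfolding e_def by (rule nn_integral_eq_integral[OF Ei]) auto
  also have "(\<integral>\<^sup>+\<xi>. g \<xi> ^ 2 \<partial>lborel) = (\<integral>\<^sup>+\<xi>. ennreal (1 / (1 + \<bar>\<xi>\<bar>)) * indicator ?A \<xi> \<partial>lborel)"
    by (intro nn_integral_cong) (auto simp: g_def indicator_def ennreal_power power_divide)
  also have "ennreal e * \<dots> \<le> ennreal e * 2" by (intro mult_left_mono nn_integral_shell_le) auto
  finally have sq: "(\<integral>\<^sup>+\<xi>. ennreal (indicator ?A \<xi> * cmod (v \<xi>)) \<partial>lborel)\<^sup>2 \<le> ennreal (e * 2)"
    using e0 by (simp add: fg ennreal_mult)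
  then have "(\<integral>\<^sup>+\<xi>. ennreal (indicator ?A \<xi> * cmod (v \<xi>)) \<partial>lborel) < \<top>"
    by (cases "(\<integral>\<^sup>+\<xi>. ennreal (indicator ?A \<xi> * cmod (v \<xi>)) \<partial>lborel)") (auto simp: power2_eq_square ennreal_top_mult top_unique)
  then show I: ?I by (intro integrableI_nonneg) auto
  have "ennreal ((LINT \<xi>|lborel. indicator ?A \<xi> * cmod (v \<xi>))\<^sup>2) \<le> ennreal (e * 2)"
    using sq unfolding nn_integral_eq_integral[OF I, simplified] by (simp add: ennreal_power integral_nonneg_AE)
  then have "(LINT \<xi>|lborel. indicator ?A \<xi> * cmod (v \<xi>))\<^sup>2 \<le> e * 2"
    using e0 by (simp add: ennreal_le_iff)
  also have "e * 2 = (sqrt 2 * sqrt e)\<^sup>2" using e0 by (simp add: power_mult_distrib)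
  finally show ?le unfolding e_def[symmetric] by (rule power2_le_imp_le) (use e0 in simp)
qed

text \<open>Compares the integrand with u^2 where \<open>u\<close> is small, a region of infinite
  measure.\<close>

lemma exp_minus_one_le: "exp y - 1 \<le> y * exp y" for y :: real
proof -
  have "1 - y \<le> exp (-y)" using exp_ge_add_one_self[of "-y"] by simp
  then have "(1 - y) * exp y \<le> exp (-y) * exp y" by (intro mult_right_mono) auto
  then show ?thesis by (simp add: algebra_simps flip: exp_add)
qed

section \<open>Rearrangement estimate for a function of the unit ball\<close>

context
  fixes u :: "real \<Rightarrow> real" and v :: "real \<Rightarrow> complex"
  assumes u: "memL2 u" and v: "is_L2_fourier u v"
    and half: "integrable lborel (\<lambda>\<xi>. \<bar>\<xi>\<bar> * (cmod (v \<xi>))\<^sup>2)"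
    and ball: "(LINT x|lborel. (u x)\<^sup>2) + (LINT \<xi>|lborel. \<bar>\<xi>\<bar> * (cmod (v \<xi>))\<^sup>2) \<le> 1"
begin

definition low_energy :: "nat \<Rightarrow> real" where
  "low_energy k = (LINT \<xi>|lborel. indicator (low_freq k) \<xi> * ((1 + \<bar>\<xi>\<bar>) * (cmod (v \<xi>))\<^sup>2))"

definition shell_amp :: "nat \<Rightarrow> real" where
  "shell_amp k = sqrt (low_energy (Suc k) - low_energy k)"

definition vlow :: "nat \<Rightarrow> real \<Rightarrow> complex" where
  "vlow k \<xi> = indicator (low_freq k) \<xi> *\<^sub>R v \<xi>"

lemma measurable_u [measurable]: "u \<in> borel_measurable borel"
  and measurable_v [measurable]: "v \<in> borel_measurable borel"
  and measurable_vlow [measurable]: "vlow k \<in> borel_measurable borel"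
proof -
  show "u \<in> borel_measurable borel" using u by (auto simp: memL2_def)
  show [measurable]: "v \<in> borel_measurable borel" using v by (auto simp: is_L2_fourier_def)
  show "vlow k \<in> borel_measurable borel" unfolding vlow_def[abs_def] by measurable
qed

lemma integrable_u2: "integrable lborel (\<lambda>x. (u x)\<^sup>2)" and integrable_v2: "integrable lborel (\<lambda>\<xi>. (cmod (v \<xi>))\<^sup>2)"
  using u v by (auto simp: memL2_def is_L2_fourier_def)

lemma integrable_energy: "integrable lborel (\<lambda>\<xi>. (1 + \<bar>\<xi>\<bar>) * (cmod (v \<xi>))\<^sup>2)"
  using half integrable_v2 by (simp add: distrib_right)

lemma integrable_energy_on:
  assumes [measurable]: "A \<in> sets borel"
  shows "integrable lborel (\<lambda>\<xi>. indicator A \<xi> * ((1 + \<bar>\<xi>\<bar>) * (cmod (v \<xi>))\<^sup>2))"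
  by (rule Bochner_Integration.integrable_bound[OF integrable_energy]) (auto simp: indicator_def)

text \<open>Plancherel rewrites the L2 part of the norm in terms of \<open>v\<close>, so the unit
  ball condition becomes a bound on one weighted integral.\<close>

lemma total_energy_le: "(LINT \<xi>|lborel. (1 + \<bar>\<xi>\<bar>) * (cmod (v \<xi>))\<^sup>2) \<le> 1"
proof -
  have "L2sq v = L2sq (\<lambda>x. complex_of_real (u x))" by (rule L2sq_L2_fourier[OF u v])
  then have "(LINT \<xi>|lborel. (cmod (v \<xi>))\<^sup>2) = (LINT x|lborel. (u x)\<^sup>2)"
    using integrable_u2 integrable_v2 by (simp add: L2sq_eq_integral)
  then show ?thesis using ball half integrable_v2 by (simp add: distrib_right)
qed

lemma low_energy_diff:
  "low_energy (Suc k) - low_energy k = (LINT \<xi>|lborel. indicator (low_freq (Suc k) - low_freq k) \<xi> * ((1 + \<bar>\<xi>\<bar>) * (cmod (v \<xi>))\<^sup>2))"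
proof -
  have "indicator (low_freq (Suc k)) \<xi> * ((1 + \<bar>\<xi>\<bar>) * (cmod (v \<xi>))\<^sup>2) - indicator (low_freq k) \<xi> * ((1 + \<bar>\<xi>\<bar>) * (cmod (v \<xi>))\<^sup>2)
    = indicator (low_freq (Suc k) - low_freq k) \<xi> * ((1 + \<bar>\<xi>\<bar>) * (cmod (v \<xi>))\<^sup>2)" for \<xi>
    using low_freq_mono[of k "Suc k"] by (auto simp: indicator_def)
  then show ?thesis
    unfolding low_energy_def by (subst Bochner_Integration.integral_diff[symmetric]) (auto intro!: integrable_energy_on)
qed

lemma shell_amp_nonneg: "0 \<le> shell_amp k" and shell_amp_sq: "(shell_amp k)\<^sup>2 = low_energy (Suc k) - low_energy k"
proof -
  have "0 \<le> low_energy (Suc k) - low_energy k" unfolding low_energy_diff by (intro integral_nonneg_AE) auto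
  then show "0 \<le> shell_amp k" "(shell_amp k)\<^sup>2 = low_energy (Suc k) - low_energy k" by (auto simp: shell_amp_def)
qed

lemma sum_amp_sq: "(\<Sum>j<k. (shell_amp j)\<^sup>2) = low_energy k"
proof -
  have "low_energy 0 = 0" by (simp add: low_energy_def)
  then show ?thesis unfolding shell_amp_sq by (subst sum_lessThan_telescope) simp
qed

lemma low_energy_le_1: "low_energy k \<le> 1"
proof -
  have "low_energy k \<le> (LINT \<xi>|lborel. (1 + \<bar>\<xi>\<bar>) * (cmod (v \<xi>))\<^sup>2)"
    unfolding low_energy_def by (intro integral_mono integrable_energy integrable_energy_on) (auto simp: indicator_def)
  with total_energy_le show ?thesis by simp
qed

lemma residual_amp_sq: "(residual shell_amp k)\<^sup>2 = 1 - low_energy k" and residual_amp_nonneg: "0 \<le> residual shell_amp k"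
  using low_energy_le_1[of k] by (auto simp: residual_def sum_amp_sq)

lemma moser_amp: "(\<Sum>k<n. exp (- deficit shell_amp k)) \<le> moser_const"
  by (rule moser_sum_le) (auto simp: shell_amp_nonneg sum_amp_sq low_energy_le_1)

lemma vlow_support: "x \<notin> {-exp (real k)..exp (real k)} \<Longrightarrow> vlow k x = 0"
  using low_freq_bounded[of k] by (auto simp: vlow_def indicator_def)

lemma L2sq_vlow: "L2sq (vlow k) < \<top>"
proof -
  have "L2sq (vlow k) \<le> L2sq v" unfolding L2sq_def vlow_def by (intro nn_integral_mono) (auto simp: indicator_def)
  also have "L2sq v < \<top>" using integrable_v2 by (simp add: L2sq_less_top_iff)
  finally show ?thesis .
qed

lemma L2sq_tail_le: "L2sq (\<lambda>\<xi>. v \<xi> - vlow k \<xi>) \<le> ennreal (exp (- real k) * (residual shell_amp k)\<^sup>2)"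
proof -
  have I: "integrable lborel (\<lambda>\<xi>. indicator (- low_freq k) \<xi> * ((1 + \<bar>\<xi>\<bar>) * (cmod (v \<xi>))\<^sup>2))"
    by (rule integrable_energy_on) simp
  have "L2sq (\<lambda>\<xi>. v \<xi> - vlow k \<xi>)
    \<le> (\<integral>\<^sup>+\<xi>. ennreal (exp (- real k) * (indicator (- low_freq k) \<xi> * ((1 + \<bar>\<xi>\<bar>) * (cmod (v \<xi>))\<^sup>2))) \<partial>lborel)"
    unfolding L2sq_def
  proof (intro nn_integral_mono ennreal_leI)
    fix \<xi>
    show "(cmod (v \<xi> - vlow k \<xi>))\<^sup>2 \<le> exp (- real k) * (indicator (- low_freq k) \<xi> * ((1 + \<bar>\<xi>\<bar>) * (cmod (v \<xi>))\<^sup>2))"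
    proof (cases "\<xi> \<in> low_freq k")
      case False
      then have "exp (real k) \<le> 1 + \<bar>\<xi>\<bar>" by (simp add: low_freq_def)
      then have "exp (- real k) * exp (real k) \<le> exp (- real k) * (1 + \<bar>\<xi>\<bar>)" by (intro mult_left_mono) auto
      then have "1 \<le> exp (- real k) * (1 + \<bar>\<xi>\<bar>)" by (simp flip: exp_add)
      then have "1 * (cmod (v \<xi>))\<^sup>2 \<le> exp (- real k) * (1 + \<bar>\<xi>\<bar>) * (cmod (v \<xi>))\<^sup>2" by (intro mult_right_mono) auto
      then show ?thesis using False by (simp add: vlow_def mult.assoc)
    qed (simp add: vlow_def)
  qed
  also have "\<dots> = ennreal (LINT \<xi>|lborel. exp (- real k) * (indicator (- low_freq k) \<xi> * ((1 + \<bar>\<xi>\<bar>) * (cmod (v \<xi>))\<^sup>2)))"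
    using I by (intro nn_integral_eq_integral) auto
  also have "\<dots> = ennreal (exp (- real k) * (LINT \<xi>|lborel. indicator (- low_freq k) \<xi> * ((1 + \<bar>\<xi>\<bar>) * (cmod (v \<xi>))\<^sup>2)))"
    by simp
  also have "(LINT \<xi>|lborel. indicator (- low_freq k) \<xi> * ((1 + \<bar>\<xi>\<bar>) * (cmod (v \<xi>))\<^sup>2)) \<le> (residual shell_amp k)\<^sup>2"
  proof -
    have "(LINT \<xi>|lborel. indicator (- low_freq k) \<xi> * ((1 + \<bar>\<xi>\<bar>) * (cmod (v \<xi>))\<^sup>2)) + low_energy k
       = (LINT \<xi>|lborel. (1 + \<bar>\<xi>\<bar>) * (cmod (v \<xi>))\<^sup>2)"
      unfolding low_energy_def
      by (subst Bochner_Integration.integral_add[OF I integrable_energy_on[OF low_freq_borel], symmetric])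
         (auto intro!: Bochner_Integration.integral_cong simp: indicator_def)
    then show ?thesis using total_energy_le by (simp add: residual_amp_sq)
  qed
  finally show ?thesis by (simp add: mult_left_mono ennreal_leI)
qed

lemma integral_vlow_le:
  "integrable lborel (\<lambda>\<xi>. cmod (vlow k \<xi>)) \<and> (LINT \<xi>|lborel. cmod (vlow k \<xi>)) \<le> sqrt 2 * (\<Sum>j<k. shell_amp j)"
proof (induction k)
  case 0
  then show ?case by (simp add: vlow_def)
next
  case (Suc k)
  have eq: "cmod (vlow (Suc k) \<xi>) = cmod (vlow k \<xi>) + indicator (low_freq (Suc k) - low_freq k) \<xi> * cmod (v \<xi>)" for \<xi>
    using low_freq_mono[of k "Suc k"] by (auto simp: vlow_def indicator_def)
  note CS = shell_Cauchy_Schwarz[OF measurable_v integrable_energy, of k, folded low_energy_diff, folded shell_amp_def]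
  show ?case unfolding eq using Suc CS by (simp add: distrib_left)
qed

text \<open>The origin of the critical constant: the factor sqrt 2 from the shell mass meets the
  normalisation 1 / sqrt (2 \<open>pi\<close>).\<close>

lemma FT_vlow_le: "cmod (FT 1 (vlow k) x) \<le> (\<Sum>j<k. shell_amp j) / sqrt pi"
proof -
  have "cmod (FT 1 (vlow k) x) \<le> (LINT \<xi>|lborel. cmod (vlow k \<xi>)) / sqrt (2 * pi)" by (rule norm_FT_le)
  also have "\<dots> \<le> (sqrt 2 * (\<Sum>j<k. shell_amp j)) / sqrt (2 * pi)"
    using integral_vlow_le[of k] by (intro divide_right_mono) auto
  also have "\<dots> = (\<Sum>j<k. shell_amp j) / sqrt pi" by (simp add: real_sqrt_mult)
  finally show ?thesis .
qed

definition level :: "nat \<Rightarrow> real" where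
  "level k = (\<Sum>j<k. shell_amp j) / sqrt pi + residual shell_amp k"

text \<open>The low frequencies account for the first term of \<open>level k\<close>, so above that
  level the high-frequency remainder must exceed the residual.\<close>

lemma emeasure_superlevel_le:
  "emeasure lborel {x. level k < \<bar>u x\<bar>} \<le> ennreal (exp (- real k))"
proof -
  let ?A = "{x. level k < \<bar>u x\<bar>}" and ?L = "residual shell_amp k"
  let ?d = "\<lambda>x. cmod (complex_of_real (u x) - FT 1 (vlow k) x)"
  have [measurable]: "?A \<in> sets borel" by measurable
  have A: "?L < ?d x" if "x \<in> ?A" for x
    using that FT_vlow_le[of k x] norm_triangle_ineq2[of "complex_of_real (u x)" "FT 1 (vlow k) x"]
    by (simp add: level_def)
  have N: "L2sq (\<lambda>x. complex_of_real (u x) - FT 1 (vlow k) x) \<le> ennreal (exp (- real k) * ?L\<^sup>2)"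
    using L2sq_diff_inverse_FT_le[OF u v measurable_vlow L2sq_vlow vlow_support] L2sq_tail_le order_trans by blast
  show ?thesis
  proof (cases "?L = 0")
    \<comment> \<open>Chebyshev at height 0 says nothing, but now the remainder vanishes almost
      everywhere, and the strict inequality makes the superlevel set null.\<close>
    case True
    then have "(\<integral>\<^sup>+x. ennreal ((?d x)\<^sup>2) \<partial>lborel) = 0" using N by (simp add: L2sq_def)
    then have "AE x in lborel. ennreal ((?d x)\<^sup>2) = 0" by (subst (asm) nn_integral_0_iff_AE) auto
    then have "AE x in lborel. x \<notin> ?A"
    proof eventually_elim
      case (elim x)
      then show ?case using A[of x] True by auto
    qed
    then have "emeasure lborel ?A = 0" by (subst (asm) AE_iff_measurable[where N = ?A]) auto
    then show ?thesis by simp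
  next
    case False
    then have L: "0 < ?L" using residual_amp_nonneg[of k] by simp
    have "ennreal (?L\<^sup>2) * emeasure lborel ?A = (\<integral>\<^sup>+x. ennreal (?L\<^sup>2) * indicator ?A x \<partial>lborel)"
      by (simp add: nn_integral_cmult_indicator)
    also have "\<dots> \<le> L2sq (\<lambda>x. complex_of_real (u x) - FT 1 (vlow k) x)"
      unfolding L2sq_def
    proof (rule nn_integral_mono)
      fix x
      show "ennreal (?L\<^sup>2) * indicator ?A x \<le> ennreal ((?d x)\<^sup>2)"
        using A[of x] L by (cases "x \<in> ?A") (auto intro!: ennreal_leI power_mono)
    qed
    also note N
    also have "ennreal (exp (- real k) * ?L\<^sup>2) = ennreal (?L\<^sup>2) * ennreal (exp (- real k))"
      by (simp add: ennreal_mult mult.commute)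
    finally show ?thesis using L by (subst (asm) ennreal_mult_le_mult_iff) auto
  qed
qed

text \<open>Since \<open>pi\<close> < 4, sqrt \<open>pi\<close> may be replaced by 2 in front of the
  residual, which is the form of the deficit.\<close>

lemma exp_level_le: "exp (pi * (level k)\<^sup>2) \<le> exp (real k) * exp (- deficit shell_amp k)"
proof -
  have "sqrt pi * level k = (\<Sum>j<k. shell_amp j) + sqrt pi * residual shell_amp k"
    by (simp add: level_def distrib_left)
  also have "\<dots> \<le> (\<Sum>j<k. shell_amp j) + 2 * residual shell_amp k"
    using pi_less_4 residual_amp_nonneg[of k] by (intro add_left_mono mult_right_mono real_le_lsqrt) auto
  finally have "(sqrt pi * level k)\<^sup>2 \<le> ((\<Sum>j<k. shell_amp j) + 2 * residual shell_amp k)\<^sup>2"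
    using residual_amp_nonneg[of k] by (intro power_mono) (auto simp: level_def shell_amp_nonneg intro!: sum_nonneg mult_nonneg_nonneg add_nonneg_nonneg divide_nonneg_nonneg)
  then have "pi * (level k)\<^sup>2 \<le> real k + - deficit shell_amp k" by (simp add: power_mult_distrib deficit_def)
  then show ?thesis by (simp flip: exp_add)
qed

text \<open>Sorting points by the first level that |u| does not exceed gives a layer-cake sum: each
  layer has measure at most e^(-k) and integrand at most e^(k+1) exp(-deficit). Where |u| is below
  level 0, the L2 norm suffices.\<close>

lemma nn_integral_critical_le:
  "(\<integral>\<^sup>+x. ennreal (exp (pi * (u x)\<^sup>2) - 1) \<partial>lborel) \<le> ennreal (pi * exp pi + exp 1 * moser_const)"
proof -
  let ?A = "\<lambda>k. {x. level k < \<bar>u x\<bar>}"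
  have [measurable]: "?A k \<in> sets borel" for k by measurable
  let ?c = "\<lambda>k. ennreal (exp (pi * (level (Suc k))\<^sup>2))"
  \<comment> \<open>Almost every point therefore drops below some level, so the least index chosen
    next exists.\<close>
  have "emeasure lborel (\<Inter>k. ?A k) = 0"
  proof -
    have "emeasure lborel (\<Inter>k. ?A k) \<le> ennreal (exp (- real k))" for k
      by (rule order_trans[OF emeasure_mono emeasure_superlevel_le]) auto
    moreover have "(\<lambda>k. ennreal (exp (- real k))) \<longlonglongrightarrow> ennreal 0"
      by (intro tendsto_ennrealI filterlim_compose[OF exp_at_bot] filterlim_compose[OF filterlim_uminus_at_bot_at_top] filterlim_real_sequentially)
    ultimately have "emeasure lborel (\<Inter>k. ?A k) \<le> ennreal 0"
      by (intro LIMSEQ_le_const[of "\<lambda>k. ennreal (exp (- real k))"]) auto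
    then show ?thesis by simp
  qed
  then have "AE x in lborel. x \<notin> (\<Inter>k. ?A k)" by (intro AE_not_in) (auto simp: null_sets_def)
  then have "AE x in lborel. ennreal (exp (pi * (u x)\<^sup>2) - 1)
      \<le> ennreal (pi * exp pi * (u x)\<^sup>2) + (\<Sum>k. ?c k * indicator (?A k) x)"
  proof eventually_elim
    case (elim x)
    \<comment> \<open>The levels may fail to be monotone, but minimality still puts \<open>x\<close>
      in the superlevel set of the preceding index.\<close>
    define m where "m = (LEAST k. x \<notin> ?A k)"
    obtain j where "x \<notin> ?A j" using elim by auto
    then have m: "x \<notin> ?A m" unfolding m_def by (rule LeastI)
    show ?case
    proof (cases m)
      case 0
      \<comment> \<open>Level 0 is 1: an empty sum and the full residual.\<close>
      then have "\<bar>u x\<bar> \<le> 1" using m by (simp add: level_def residual_def)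
      then have u1: "(u x)\<^sup>2 \<le> 1" by (simp add: abs_square_le_1)
      have "exp (pi * (u x)\<^sup>2) - 1 \<le> pi * (u x)\<^sup>2 * exp (pi * (u x)\<^sup>2)" by (rule exp_minus_one_le)
      also have "\<dots> \<le> pi * (u x)\<^sup>2 * exp pi"
        using u1 by (intro mult_left_mono) auto
      finally have "ennreal (exp (pi * (u x)\<^sup>2) - 1) \<le> ennreal (pi * exp pi * (u x)\<^sup>2)"
        by (intro ennreal_leI) (simp add: mult_ac)
      then show ?thesis by (rule order_trans) simp
    next
      case (Suc k)
      then have "x \<in> ?A k" using not_less_Least[of k "\<lambda>k. x \<notin> ?A k"] by (auto simp: m_def)
      have le: "\<bar>u x\<bar> \<le> level (Suc k)" using m Suc by simp
      then have "(u x)\<^sup>2 \<le> (level (Suc k))\<^sup>2" by (metis abs_ge_zero power2_abs power_mono)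
      then have "exp (pi * (u x)\<^sup>2) - 1 \<le> exp (pi * (level (Suc k))\<^sup>2)"
        by (smt (verit) exp_le_cancel_iff mult_left_mono pi_gt_zero)
      then have "ennreal (exp (pi * (u x)\<^sup>2) - 1) \<le> ?c k * indicator (?A k) x"
        using \<open>x \<in> ?A k\<close> by (simp add: ennreal_leI)
      also have "\<dots> \<le> (\<Sum>k. ?c k * indicator (?A k) x)"
      proof -
        define f where "f k = ?c k * indicator (?A k) x" for k
        have "f k \<le> suminf f" using sum_le_suminf[of f "{k}"] by simp
        then show ?thesis unfolding f_def[abs_def] .
      qed
      finally show ?thesis by (rule order_trans) simp
    qed
  qed
  then have "(\<integral>\<^sup>+x. ennreal (exp (pi * (u x)\<^sup>2) - 1) \<partial>lborel)
     \<le> (\<integral>\<^sup>+x. ennreal (pi * exp pi * (u x)\<^sup>2) + (\<Sum>k. ?c k * indicator (?A k) x) \<partial>lborel)"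
    by (rule nn_integral_mono_AE)
  also have "\<dots> = (\<integral>\<^sup>+x. ennreal (pi * exp pi * (u x)\<^sup>2) \<partial>lborel) + (\<Sum>k. ?c k * emeasure lborel (?A k))"
    by (simp add: nn_integral_add nn_integral_suminf nn_integral_cmult_indicator)
  also have "(\<integral>\<^sup>+x. ennreal (pi * exp pi * (u x)\<^sup>2) \<partial>lborel) = ennreal (pi * exp pi * (LINT x|lborel. (u x)\<^sup>2))"
    using integrable_u2 by (subst nn_integral_eq_integral) auto
  also have "\<dots> \<le> ennreal (pi * exp pi)"
  proof -
    have "0 \<le> (LINT \<xi>|lborel. \<bar>\<xi>\<bar> * (cmod (v \<xi>))\<^sup>2)" by (intro integral_nonneg_AE) auto
    then have "(LINT x|lborel. (u x)\<^sup>2) \<le> 1" using ball by linarith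
    then show ?thesis by (intro ennreal_leI) simp
  qed
  also have "(\<Sum>k. ?c k * emeasure lborel (?A k)) \<le> ennreal (exp 1 * moser_const)"
  proof (rule suminf_le_const)
    fix n
    have "(\<Sum>k<n. ?c k * emeasure lborel (?A k)) \<le> (\<Sum>k<n. ennreal (exp 1 * exp (- deficit shell_amp (Suc k))))"
    proof (rule sum_mono)
      fix k
      have "?c k * emeasure lborel (?A k) \<le> ennreal (exp (real (Suc k)) * exp (- deficit shell_amp (Suc k))) * ennreal (exp (- real k))"
        by (intro mult_mono ennreal_leI exp_level_le emeasure_superlevel_le) auto
      \<comment> \<open>The measure is taken at index k and the height at k + 1, which costs one
        factor e.\<close>
      also have "\<dots> = ennreal (exp 1 * exp (- deficit shell_amp (Suc k)))"
        by (simp add: ennreal_mult[symmetric] flip: exp_add)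
      finally show "?c k * emeasure lborel (?A k) \<le> ennreal (exp 1 * exp (- deficit shell_amp (Suc k)))" .
    qed
    also have "\<dots> = ennreal (exp 1 * (\<Sum>k<n. exp (- deficit shell_amp (Suc k))))"
      by (simp add: sum_ennreal sum_distrib_left)
    also have "\<dots> \<le> ennreal (exp 1 * moser_const)"
    proof (intro ennreal_leI mult_left_mono)
      have "(\<Sum>k<n. exp (- deficit shell_amp (Suc k))) \<le> (\<Sum>k<Suc n. exp (- deficit shell_amp k))"
        by (simp add: sum.lessThan_Suc_shift del: sum.lessThan_Suc)
      also have "\<dots> \<le> moser_const" by (rule moser_amp)
      finally show "(\<Sum>k<n. exp (- deficit shell_amp (Suc k))) \<le> moser_const" .
    qed simp
    finally show "(\<Sum>k<n. ?c k * emeasure lborel (?A k)) \<le> ennreal (exp 1 * moser_const)" .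
  qed simp
  \<comment> \<open>The empty sum \<open>moser_amp[of 0]\<close> shows that the constant is
    nonnegative, as needed to add within \<open>ennreal\<close>.\<close>
  finally show ?thesis
    using order_trans[OF _ moser_amp[of 0]] moser_amp[of 0] by (simp add: add_mono ennreal_plus)
qed

end

declare measurable_u [measurable del] measurable_v [measurable del] measurable_vlow [measurable del]

lemma critical_sup_finite:
  "(SUP u\<in>H12_unit_ball. \<integral>\<^sup>+ x. ennreal (exp (pi * (u x)\<^sup>2) - 1) \<partial>lborel) < \<infinity>"
proof -
  have "(SUP u\<in>H12_unit_ball. \<integral>\<^sup>+ x. ennreal (exp (pi * (u x)\<^sup>2) - 1) \<partial>lborel) \<le> ennreal (pi * exp pi + exp 1 * moser_const)"
    by (rule SUP_least) (auto simp: H12_unit_ball_def intro: nn_integral_critical_le)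
  then show ?thesis by (simp add: le_less_trans)
qed

section \<open>Sharpness\<close>

lemma FT_even:
  assumes "\<And>x. f (- x) = f x"
  shows "FT (- s) f \<xi> = FT s f \<xi>"
proof -
  have "(LINT x|lborel. cis (- s * x * \<xi>) * f x)
    = \<bar>-1\<bar> *\<^sub>R (LINT x|lborel. cis (- s * (0 + -1 * x) * \<xi>) * f (0 + -1 * x))"
    by (rule lborel_integral_real_affine) simp
  then show ?thesis by (simp add: FT_def assms)
qed

text \<open>The converse passage, from a prescribed \<open>v\<close> of bounded support to a
  function whose transform it is; this is how test functions are produced.\<close>

lemma L2_fourier_of_inverse_FT:
  assumes [measurable]: "v \<in> borel_measurable borel" "u \<in> borel_measurable borel"
    and v2: "L2sq v < \<top>" and vs: "\<And>x. x \<notin> {-S..S} \<Longrightarrow> v x = 0"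
    and uv: "\<And>x. complex_of_real (u x) = FT 1 v x"
  shows "memL2 u" "is_L2_fourier u v" "(LINT x|lborel. (u x)\<^sup>2) \<le> (LINT x|lborel. (cmod (v x))\<^sup>2)"
proof -
  let ?u = "\<lambda>x. complex_of_real (u x)"
  have vi: "integrable lborel v" by (rule integrable_of_L2_support[OF _ v2 vs]) auto
  have v2': "integrable lborel (\<lambda>x. (cmod (v x))\<^sup>2)" using v2 by (simp add: L2sq_less_top_iff)
  have le: "L2sq ?u \<le> L2sq v" unfolding uv by (rule Bessel_FT[OF vi]) simp
  then have "L2sq ?u < \<top>" using v2 by (rule le_less_trans)
  then have u2: "integrable lborel (\<lambda>x. (cmod (?u x))\<^sup>2)" by (simp add: L2sq_less_top_iff)
  then show "memL2 u" by (simp add: memL2_def)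
  show "(LINT x|lborel. (u x)\<^sup>2) \<le> (LINT x|lborel. (cmod (v x))\<^sup>2)"
    using le unfolding L2sq_eq_integral[OF u2] L2sq_eq_integral[OF v2'] by (simp add: ennreal_le_iff integral_nonneg_AE)
  have "((\<lambda>R. L2sq (\<lambda>x. v x - fourier_trunc u R x)) \<longlongrightarrow> 0) at_top"
  \<comment> \<open>Testing the limit along sequences makes dominated convergence available.\<close>
  proof (rule tendsto_at_topI_sequentially)
    fix X :: "nat \<Rightarrow> real" assume X: "filterlim X at_top sequentially"
    define un where "un n x = indicator {-X n..X n} x *\<^sub>R ?u x" for n x
    have [measurable]: "un n \<in> borel_measurable borel" for n unfolding un_def[abs_def] by measurable
    have lim: "(\<lambda>n. L2sq (\<lambda>x. un n x - ?u x)) \<longlonglongrightarrow> 0"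
    proof (rule L2sq_tendsto_dominated[where w = "\<lambda>x. (u x)\<^sup>2"])
      have "(\<lambda>n. un n x) \<longlonglongrightarrow> ?u x" for x
      proof (rule tendsto_eventually)
        have "eventually (\<lambda>n. \<bar>x\<bar> \<le> X n) sequentially"
          using X by (simp add: filterlim_at_top)
        then show "eventually (\<lambda>n. un n x = ?u x) sequentially"
          by eventually_elim (auto simp: un_def indicator_def)
      qed
      then show "AE x in lborel. (\<lambda>n. un n x) \<longlonglongrightarrow> ?u x" by simp
    qed (use u2 in \<open>auto simp: un_def indicator_def\<close>)
    have bound: "L2sq (\<lambda>x. v x - fourier_trunc u (X n) x) \<le> L2sq (\<lambda>x. un n x - ?u x)" for n
    proof -
      have "L2sq (un n) \<le> L2sq ?u"
        unfolding L2sq_def un_def by (intro nn_integral_mono) (auto simp: indicator_def)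
      then have un2: "L2sq (un n) < \<top>" using \<open>L2sq ?u < \<top>\<close> by (rule le_less_trans)
      have uns: "un n x = 0" if "x \<notin> {-X n..X n}" for x using that by (simp add: un_def)
      \<comment> \<open>The roles are exchanged: \<open>v\<close> is the given function and the
        truncation of \<open>u\<close> is the one transformed, so the error is the L2 tail of
        \<open>u\<close>.\<close>
      have "L2sq (\<lambda>x. v x - FT (-1) (un n) x) \<le> L2sq (\<lambda>x. FT (- (-1)) v x - un n x)"
        by (rule L2sq_diff_FT_le[OF _ _ v2 un2 vs uns]) auto
      moreover have "fourier_trunc u (X n) = FT (-1) (un n)"
        by (simp add: fourier_trunc_eq_FT un_def[abs_def])
      ultimately show ?thesis
        by (simp add: L2sq_def norm_minus_commute flip: uv)
    qed
    show "(\<lambda>n. L2sq (\<lambda>x. v x - fourier_trunc u (X n) x)) \<longlonglongrightarrow> 0"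
      by (rule tendsto_sandwich[OF _ _ tendsto_const lim]) (use bound in auto)
  qed
  then show "is_L2_fourier u v"
    using v2' by (simp add: is_L2_fourier_def L2sq_def)
qed

lemma has_bochner_integral_even_Icc:
  fixes f :: "real \<Rightarrow> real"
  assumes "has_bochner_integral lborel (\<lambda>x. f x * indicator {1..N} x) I"
  shows "has_bochner_integral lborel (\<lambda>x. f \<bar>x\<bar> * indicator {1..N} \<bar>x\<bar>) (2 * I)"
proof -
  have "has_bochner_integral lborel (\<lambda>x. f (0 + -1 * x) * indicator {1..N} (0 + -1 * x)) (I /\<^sub>R \<bar>-1\<bar>)"
    using assms by (subst (asm) lborel_has_bochner_integral_real_affine_iff[of "-1" _ _ 0]) auto
  from has_bochner_integral_add[OF assms this]
  have "has_bochner_integral lborel (\<lambda>x. f x * indicator {1..N} x + f (0 + -1 * x) * indicator {1..N} (0 + -1 * x)) (2 * I)"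
    by simp
  also have "(\<lambda>x. f x * indicator {1..N} x + f (0 + -1 * x) * indicator {1..N} (0 + -1 * x)) = (\<lambda>x. f \<bar>x\<bar> * indicator {1..N} \<bar>x\<bar>)"
    by (auto simp: fun_eq_iff indicator_def abs_if)
  finally show ?thesis .
qed

text \<open>The logarithm truncated at scale \<open>1/N\<close>, written on the Fourier side as a multiple of
  \<open>1/\<bar>\<xi>\<bar>\<close> on \<open>1 \<le> \<bar>\<xi>\<bar> \<le> N\<close>.\<close>
lemma Moser_function:
  assumes N: "1 \<le> ln N" "0 < N"
  shows "\<exists>u \<in> H12_unit_ball. \<forall>x. \<bar>x\<bar> \<le> 1 / N \<longrightarrow> ln N - 2 \<le> pi * (u x)\<^sup>2"
proof -
  have N1: "1 \<le> N" using N ln_ge_zero_iff[of N] by linarith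
  \<comment> \<open>Normalises the energy: the half-derivative part is 2 a^2 ln N and the L2 part at
    most 2 a^2.\<close>
  define a where "a = sqrt (1 / (2 * (ln N + 1)))"
  have a: "0 \<le> a" "a\<^sup>2 = 1 / (2 * (ln N + 1))" using N by (auto simp: a_def)
  define v where "v \<xi> = complex_of_real (a * (1 / \<bar>\<xi>\<bar> * indicator {1..N} \<bar>\<xi>\<bar>))" for \<xi>
  define u where "u x = Re (FT 1 v x)" for x
  have mv [measurable]: "v \<in> borel_measurable borel" unfolding v_def[abs_def] by measurable
  have mu [measurable]: "u \<in> borel_measurable borel" unfolding u_def[abs_def] by measurable
  have cv: "cmod (v \<xi>) = a * (1 / \<bar>\<xi>\<bar> * indicator {1..N} \<bar>\<xi>\<bar>)" for \<xi>
    using a by (simp add: v_def norm_mult norm_divide indicator_def)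
  have "complex_of_real (u x) = FT 1 v x" for x
  proof -
    have "(\<lambda>\<xi>. cnj (v \<xi>)) = v" by (simp add: v_def fun_eq_iff)
    then have "cnj (FT 1 v x) = FT (-1) v x" by (simp add: cnj_FT)
    also have "\<dots> = FT 1 v x" by (rule FT_even) (simp add: v_def)
    finally show ?thesis by (simp add: u_def complex_eq_iff)
  qed
  note uv = this
  have I1: "has_bochner_integral lborel (\<lambda>\<xi>. 1 / \<bar>\<xi>\<bar> * indicator {1..N} \<bar>\<xi>\<bar>) (2 * (ln N - ln 1))"
    by (rule has_bochner_integral_even_Icc[of "\<lambda>x. 1 / x"], rule has_bochner_integral_FTC_Icc_nonneg[where F = ln])
       (use N1 in \<open>auto intro!: derivative_eq_intros\<close>)
  have I2: "has_bochner_integral lborel (\<lambda>\<xi>. 1 / \<bar>\<xi>\<bar>\<^sup>2 * indicator {1..N} \<bar>\<xi>\<bar>) (2 * (- (1 / N) - (- (1 / 1))))"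
    by (rule has_bochner_integral_even_Icc[of "\<lambda>x. 1 / x\<^sup>2"], rule has_bochner_integral_FTC_Icc_nonneg[where F = "\<lambda>x. - (1 / x)"])
       (use N1 in \<open>auto intro!: derivative_eq_intros simp: power2_eq_square\<close>)
  \<comment> \<open>The minorant of the integrand of \<open>u\<close> near 0 obtained from the
    cosine bound below.\<close>
  have I3: "has_bochner_integral lborel (\<lambda>\<xi>. (1 / \<bar>\<xi>\<bar> - 1 / (2 * N)) * indicator {1..N} \<bar>\<xi>\<bar>)
      (2 * ((ln N - N / (2 * N)) - (ln 1 - 1 / (2 * N))))"
  proof (rule has_bochner_integral_even_Icc, rule has_bochner_integral_FTC_Icc_nonneg[where F = "\<lambda>x. ln x - x / (2 * N)"])
    fix x assume x: "x \<in> {1..N}"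
    show "((\<lambda>x. ln x - x / (2 * N)) has_real_derivative 1 / x - 1 / (2 * N)) (at x)"
      using x N by (auto intro!: derivative_eq_intros)
    show "0 \<le> 1 / x - 1 / (2 * N)"
      using x N by (simp add: field_simps)
  qed (use N1 in auto)
  have v_sq: "(cmod (v \<xi>))\<^sup>2 = a\<^sup>2 * (1 / \<bar>\<xi>\<bar>\<^sup>2 * indicator {1..N} \<bar>\<xi>\<bar>)" for \<xi>
    by (simp add: cv power_mult_distrib power_divide indicator_def)
  have v_half: "\<bar>\<xi>\<bar> * (cmod (v \<xi>))\<^sup>2 = a\<^sup>2 * (1 / \<bar>\<xi>\<bar> * indicator {1..N} \<bar>\<xi>\<bar>)" for \<xi>
    unfolding v_sq by (cases "\<xi> = 0") (auto simp: power2_eq_square indicator_def field_simps)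
  have v2: "has_bochner_integral lborel (\<lambda>\<xi>. (cmod (v \<xi>))\<^sup>2) (a\<^sup>2 * (2 * (- (1 / N) - (- (1 / 1)))))"
    unfolding v_sq by (intro has_bochner_integral_mult_right I2)
  have vh: "has_bochner_integral lborel (\<lambda>\<xi>. \<bar>\<xi>\<bar> * (cmod (v \<xi>))\<^sup>2) (a\<^sup>2 * (2 * (ln N - ln 1)))"
    unfolding v_half by (intro has_bochner_integral_mult_right I1)
  have Nv: "L2sq v < \<top>" using v2 by (simp add: L2sq_less_top_iff has_bochner_integral_iff)
  have vs: "v x = 0" if "x \<notin> {-N..N}" for x using that by (auto simp: v_def indicator_def)
  note F = L2_fourier_of_inverse_FT[OF mv mu Nv vs uv]
  have "u \<in> H12_unit_ball"
  proof -
    have "(LINT x|lborel. (u x)\<^sup>2) + (LINT \<xi>|lborel. \<bar>\<xi>\<bar> * (cmod (v \<xi>))\<^sup>2)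
       \<le> a\<^sup>2 * (2 * (- (1 / N) - (- (1 / 1)))) + a\<^sup>2 * (2 * (ln N - ln 1))"
      using F(3) v2 vh by (simp add: has_bochner_integral_iff)
    also have "\<dots> = a\<^sup>2 * (2 * (ln N + 1)) - 2 * a\<^sup>2 / N" by (simp add: algebra_simps)
    also have "\<dots> \<le> a\<^sup>2 * (2 * (ln N + 1))" using N by simp
    also have "\<dots> = 1" using N by (simp add: a(2))
    finally show ?thesis
      unfolding H12_unit_ball_def using F(1,2) vh by (auto intro!: exI[of _ v] simp: has_bochner_integral_iff)
  qed
  moreover have "ln N - 2 \<le> pi * (u x)\<^sup>2" if x: "\<bar>x\<bar> \<le> 1 / N" for x
  proof -
    \<comment> \<open>As |x \<xi>| \<le> |\<xi>|/N \<le> 1, the quadratic cosine error is at most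
      |\<xi>|/(2N). Being linear in |\<xi>|, it costs only a bounded amount against the density
      1/|\<xi>|.\<close>
    have cosb: "1 - \<bar>\<xi>\<bar> / (2 * N) \<le> cos (x * \<xi>)" if \<xi>: "\<bar>\<xi>\<bar> \<le> N" for \<xi>
    proof -
      have le: "\<bar>x * \<xi>\<bar> \<le> \<bar>\<xi>\<bar> / N" using mult_right_mono[OF x abs_ge_zero[of \<xi>]] by (simp add: abs_mult)
      also have "\<dots> \<le> 1" using \<xi> N by simp
      finally have "\<bar>x * \<xi>\<bar> * \<bar>x * \<xi>\<bar> \<le> \<bar>x * \<xi>\<bar> * 1" by (intro mult_left_mono) auto
      then have sq: "(x * \<xi>)\<^sup>2 \<le> \<bar>\<xi>\<bar> / N" using le by (simp add: power2_eq_square abs_mult_self)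
      have "\<bar>sin (x * \<xi> / 2)\<bar> \<le> \<bar>x * \<xi> / 2\<bar>" by (rule abs_sin_x_le_abs_x)
      then have "\<bar>sin (x * \<xi> / 2)\<bar>\<^sup>2 \<le> \<bar>x * \<xi> / 2\<bar>\<^sup>2" by (rule power_mono) simp
      then have "(sin (x * \<xi> / 2))\<^sup>2 \<le> (x * \<xi>)\<^sup>2 / 4" by (simp add: power_divide)
      moreover have "cos (x * \<xi>) = 1 - 2 * (sin (x * \<xi> / 2))\<^sup>2" using cos_double_sin[of "x * \<xi> / 2"] by simp
      ultimately show ?thesis using sq by (simp add: field_simps)
    qed
    have vi: "integrable lborel v" by (rule integrable_of_L2_support[OF _ Nv vs]) auto
    have "u x = Re (LINT \<xi>|lborel. cis (1 * \<xi> * x) * v \<xi>) / sqrt (2 * pi)" by (simp add: u_def FT_def)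
    also have "Re (LINT \<xi>|lborel. cis (1 * \<xi> * x) * v \<xi>) = (LINT \<xi>|lborel. Re (cis (1 * \<xi> * x) * v \<xi>))"
      by (rule integral_Re[symmetric]) (rule integrable_cis_mult[OF vi])
    finally have ux: "u x = (LINT \<xi>|lborel. Re (cis (1 * \<xi> * x) * v \<xi>)) / sqrt (2 * pi)" .
    have "a * (2 * ((ln N - N / (2 * N)) - (ln 1 - 1 / (2 * N)))) = (LINT \<xi>|lborel. a * ((1 / \<bar>\<xi>\<bar> - 1 / (2 * N)) * indicator {1..N} \<bar>\<xi>\<bar>))"
      using I3 by (simp add: has_bochner_integral_iff)
    also have "\<dots> \<le> (LINT \<xi>|lborel. Re (cis (1 * \<xi> * x) * v \<xi>))"
    proof (rule integral_mono)
      show "integrable lborel (\<lambda>\<xi>. a * ((1 / \<bar>\<xi>\<bar> - 1 / (2 * N)) * indicator {1..N} \<bar>\<xi>\<bar>))"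
        using I3 by (simp add: has_bochner_integral_iff)
      show "integrable lborel (\<lambda>\<xi>. Re (cis (1 * \<xi> * x) * v \<xi>))"
        by (rule integrable_Re) (rule integrable_cis_mult[OF vi])
      show "a * ((1 / \<bar>\<xi>\<bar> - 1 / (2 * N)) * indicator {1..N} \<bar>\<xi>\<bar>) \<le> Re (cis (1 * \<xi> * x) * v \<xi>)" for \<xi>
      proof (cases "\<bar>\<xi>\<bar> \<in> {1..N}")
        case True
        then have "(1 - \<bar>\<xi>\<bar> / (2 * N)) * (a / \<bar>\<xi>\<bar>) \<le> cos (x * \<xi>) * (a / \<bar>\<xi>\<bar>)"
          using a by (intro mult_right_mono cosb) auto
        moreover have "(1 - \<bar>\<xi>\<bar> / (2 * N)) * (a / \<bar>\<xi>\<bar>) = a * (1 / \<bar>\<xi>\<bar> - 1 / (2 * N))"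
          using True N by (auto simp: field_simps)
        ultimately show ?thesis using True by (simp add: v_def mult.commute[of x])
      qed (simp add: v_def)
    qed
    finally have "a * (2 * ln N - 1) \<le> (LINT \<xi>|lborel. Re (cis (1 * \<xi> * x) * v \<xi>))"
      using a N by (auto simp: algebra_simps intro: order_trans[rotated])
    then have "a * (2 * ln N - 1) / sqrt (2 * pi) \<le> u x" unfolding ux by (rule divide_right_mono) simp
    then have "(a * (2 * ln N - 1) / sqrt (2 * pi))\<^sup>2 \<le> (u x)\<^sup>2"
      using a N by (intro power_mono) auto
    then have "pi * (a * (2 * ln N - 1) / sqrt (2 * pi))\<^sup>2 \<le> pi * (u x)\<^sup>2" by simp
    moreover have "pi * (a * (2 * ln N - 1) / sqrt (2 * pi))\<^sup>2 = a\<^sup>2 * (2 * ln N - 1)\<^sup>2 / 2"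
      by (simp add: power_divide power_mult_distrib)
    moreover have "a\<^sup>2 * (2 * ln N - 1)\<^sup>2 / 2 = (2 * ln N - 1)\<^sup>2 / (4 * (ln N + 1))"
      using N by (simp add: a(2))
    \<comment> \<open>With t = ln N this is (2t - 1)^2 \<ge> 4 (t - 2)(t + 1), whose two sides
      differ by 9.\<close>
    moreover have "ln N - 2 \<le> (2 * ln N - 1)\<^sup>2 / (4 * (ln N + 1))"
      using N by (simp add: field_simps power2_eq_square)
    ultimately show ?thesis by linarith
  qed
  ultimately show ?thesis by blast
qed

text \<open>Near 0 the Moser function makes the critical integrand at least a multiple of N on an
  interval of length 2/N. This mass does not vanish as N grows, while |u| there exceeds any given
  height, so the factor h(|u|) is as large as desired.\<close>

lemma supercritical_sup_infinite:
  fixes h :: "real \<Rightarrow> real"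
  assumes h0: "\<forall>t\<ge>0. h t \<ge> 0" and h: "filterlim (\<lambda>t. h t / t\<^sup>2) at_top at_top"
  shows "(SUP u\<in>H12_unit_ball. \<integral>\<^sup>+ x. ennreal (h \<bar>u x\<bar> * (exp (pi * (u x)\<^sup>2) - 1)) \<partial>lborel) = \<infinity>"
proof -
  have bound: "ennreal M \<le> (SUP u\<in>H12_unit_ball. \<integral>\<^sup>+ x. ennreal (h \<bar>u x\<bar> * (exp (pi * (u x)\<^sup>2) - 1)) \<partial>lborel)"
    if M: "0 < M" for M :: real
  proof -
    \<comment> \<open>The term e^(-2) is the loss in the exponent of the Moser function, and N
      e^(-3) \<ge> 1 pays for the subtracted 1.\<close>
    define c where "c = exp (-2) - exp (-3 :: real)"
    have c: "0 < c" by (simp add: c_def)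
    define M' where "M' = M / (2 * c)"
    have M': "0 < M'" using M c by (simp add: M'_def)
    have "eventually (\<lambda>t. M' \<le> h t / t\<^sup>2 \<and> 1 \<le> t) at_top"
      using h by (intro eventually_conj eventually_ge_at_top) (auto simp: filterlim_at_top)
    then obtain t0 where t0: "\<And>t. t0 \<le> t \<Longrightarrow> M' \<le> h t / t\<^sup>2 \<and> 1 \<le> t"
      by (auto simp: eventually_at_top_linorder)
    have ht: "M' \<le> h t" if "t0 \<le> t" for t
    proof -
      have "1 \<le> t" "M' \<le> h t / t\<^sup>2" using t0[OF that] by auto
      then have "M' * t\<^sup>2 \<le> h t" by (simp add: field_simps)
      moreover have "M' * 1 \<le> M' * t\<^sup>2" using M' \<open>1 \<le> t\<close> by (intro mult_left_mono) auto
      ultimately show ?thesis by simp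
    qed
    \<comment> \<open>Large enough that ln N - 2 exceeds \<open>pi * t0\<^sup>2\<close> and that N
      \<ge> e^3.\<close>
    define N where "N = exp (3 + pi * t0\<^sup>2)"
    have N: "0 < N" "ln N = 3 + pi * t0\<^sup>2" by (auto simp: N_def)
    have "1 \<le> ln N" using N by simp
    then obtain u where u: "u \<in> H12_unit_ball" and ux: "\<And>x. \<bar>x\<bar> \<le> 1 / N \<Longrightarrow> ln N - 2 \<le> pi * (u x)\<^sup>2"
      using Moser_function N by blast
    have "ennreal M = ennreal (M' * (N * c)) * emeasure lborel {-(1/N)..1/N}"
      using M c N M' by (simp add: M'_def ennreal_mult[symmetric] field_simps)
    also have "\<dots> = (\<integral>\<^sup>+x. ennreal (M' * (N * c)) * indicator {-(1/N)..1/N} x \<partial>lborel)"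
      by (simp add: nn_integral_cmult_indicator)
    also have "\<dots> \<le> (\<integral>\<^sup>+ x. ennreal (h \<bar>u x\<bar> * (exp (pi * (u x)\<^sup>2) - 1)) \<partial>lborel)"
    \<comment> \<open>As \<open>h\<close> is arbitrary, the integrand may be non-measurable. The
      integral is a supremum over simple functions below it and remains monotone.\<close>
    proof (rule nn_integral_mono)
      fix x
      show "ennreal (M' * (N * c)) * indicator {-(1/N)..1/N} x \<le> ennreal (h \<bar>u x\<bar> * (exp (pi * (u x)\<^sup>2) - 1))"
      proof (cases "x \<in> {-(1/N)..1/N}")
        case True
        then have le: "ln N - 2 \<le> pi * (u x)\<^sup>2" by (intro ux) auto
        then have "pi * t0\<^sup>2 \<le> pi * (u x)\<^sup>2" unfolding N by linarith
        then have "t0\<^sup>2 \<le> (u x)\<^sup>2" by (rule mult_left_le_imp_le[OF _ pi_gt_zero])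
        then have "t0\<^sup>2 \<le> \<bar>u x\<bar>\<^sup>2" by simp
        then have "t0 \<le> \<bar>u x\<bar>" by (rule power2_le_imp_le) simp
        then have hM: "M' \<le> h \<bar>u x\<bar>" by (rule ht)
        have "exp (ln N - 2) \<le> exp (pi * (u x)\<^sup>2)" using le by simp
        moreover have "exp (ln N - 2) = N * exp (-2)" using N(1) by (simp add: exp_diff exp_minus divide_inverse)
        ultimately have "N * exp (-2) \<le> exp (pi * (u x)\<^sup>2)" by simp
        moreover have "exp 3 \<le> N" unfolding N_def by simp
        then have "exp (-3) * exp 3 \<le> exp (-3) * N" by (intro mult_left_mono) auto
        then have "1 \<le> N * exp (-3)" by (simp add: mult.commute flip: exp_add)
        ultimately have "N * c \<le> exp (pi * (u x)\<^sup>2) - 1" by (simp add: c_def right_diff_distrib)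
        then have "M' * (N * c) \<le> h \<bar>u x\<bar> * (exp (pi * (u x)\<^sup>2) - 1)"
          using hM M' N c by (intro mult_mono) auto
        then show ?thesis using True by (simp add: ennreal_leI)
      qed simp
    qed
    also have "\<dots> \<le> (SUP u\<in>H12_unit_ball. \<integral>\<^sup>+ x. ennreal (h \<bar>u x\<bar> * (exp (pi * (u x)\<^sup>2) - 1)) \<partial>lborel)"
      by (rule SUP_upper[OF u])
    finally show ?thesis .
  qed
  show ?thesis
  proof (cases "SUP u\<in>H12_unit_ball. \<integral>\<^sup>+ x. ennreal (h \<bar>u x\<bar> * (exp (pi * (u x)\<^sup>2) - 1)) \<partial>lborel")
    case (real r)
    then show ?thesis using bound[of "r + 1"] by (simp add: ennreal_le_iff)
  qed simp
qed

text \<open>The excess exponent acts as a weight, h(t) = exp((\<alpha> - \<open>pi\<close>) t^2).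
  This weight is at least 1, so multiplying exp(\<open>pi\<close> u^2) - 1 by it stays below
  exp(\<alpha> u^2) - 1.\<close>

lemma exponent_sharp:
  assumes "\<alpha> > pi"
  shows "(SUP u\<in>H12_unit_ball. \<integral>\<^sup>+ x. ennreal (exp (\<alpha> * (u x)\<^sup>2) - 1) \<partial>lborel) = \<infinity>"
proof -
  define c where "c = \<alpha> - pi"
  have c: "0 < c" using assms by (simp add: c_def)
  \<comment> \<open>The quadratic Taylor term of exp(c t^2), divided by t^2, already
    diverges.\<close>
  have "filterlim (\<lambda>t::real. c\<^sup>2 / 2 * t ^ 2) at_top at_top"
    using c by (intro filterlim_tendsto_pos_mult_at_top[OF tendsto_const] filterlim_pow_at_top filterlim_ident) auto
  then have "filterlim (\<lambda>t. exp (c * t\<^sup>2) / t\<^sup>2) at_top at_top"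
  proof (rule filterlim_at_top_mono)
    show "eventually (\<lambda>t. c\<^sup>2 / 2 * t ^ 2 \<le> exp (c * t\<^sup>2) / t\<^sup>2) at_top"
      using eventually_gt_at_top[of 0]
    proof eventually_elim
      case (elim t)
      have "(c * t\<^sup>2)\<^sup>2 / 2 \<le> exp (c * t\<^sup>2)"
        using exp_lower_Taylor_quadratic[of "c * t\<^sup>2"] c by (smt (verit) mult_nonneg_nonneg zero_le_power2)
      then show ?case using elim by (simp add: field_simps power2_eq_square)
    qed
  qed
  then have inf: "(SUP u\<in>H12_unit_ball. \<integral>\<^sup>+ x. ennreal (exp (c * \<bar>u x\<bar>\<^sup>2) * (exp (pi * (u x)\<^sup>2) - 1)) \<partial>lborel) = \<infinity>"
    by (intro supercritical_sup_infinite) auto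
  have "(SUP u\<in>H12_unit_ball. \<integral>\<^sup>+ x. ennreal (exp (c * \<bar>u x\<bar>\<^sup>2) * (exp (pi * (u x)\<^sup>2) - 1)) \<partial>lborel)
     \<le> (SUP u\<in>H12_unit_ball. \<integral>\<^sup>+ x. ennreal (exp (\<alpha> * (u x)\<^sup>2) - 1) \<partial>lborel)"
  proof (intro SUP_mono' nn_integral_mono ennreal_leI)
    fix u :: "real \<Rightarrow> real" and x
    have "1 \<le> exp (c * \<bar>u x\<bar>\<^sup>2)" using c by simp
    moreover have "exp (c * \<bar>u x\<bar>\<^sup>2) * exp (pi * (u x)\<^sup>2) = exp (\<alpha> * (u x)\<^sup>2)"
      by (simp add: c_def algebra_simps flip: exp_add)
    ultimately show "exp (c * \<bar>u x\<bar>\<^sup>2) * (exp (pi * (u x)\<^sup>2) - 1) \<le> exp (\<alpha> * (u x)\<^sup>2) - 1"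
      by (simp add: right_diff_distrib)
  qed
  then show ?thesis unfolding inf by (simp only: infinity_ennreal_def top_unique)
qed

theorem theorem1p6:
  shows "(SUP u\<in>H12_unit_ball. \<integral>\<^sup>+ x. ennreal (exp (pi * (u x)\<^sup>2) - 1) \<partial>lborel) < \<infinity>
    \<and> (\<forall>h :: real \<Rightarrow> real.
           (\<forall>t\<ge>0. h t \<ge> 0) \<longrightarrow> filterlim (\<lambda>t. h t / t\<^sup>2) at_top at_top \<longrightarrow>
           (SUP u\<in>H12_unit_ball.
              \<integral>\<^sup>+ x. ennreal (h \<bar>u x\<bar> * (exp (pi * (u x)\<^sup>2) - 1)) \<partial>lborel) = \<infinity>)
    \<and> (\<forall>\<alpha> :: real. \<alpha> > pi \<longrightarrow>
           (SUP u\<in>H12_unit_ball. \<integral>\<^sup>+ x. ennreal (exp (\<alpha> * (u x)\<^sup>2) - 1) \<partial>lborel) = \<infinity>)"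
proof (intro conjI)
  show "\<forall>h :: real \<Rightarrow> real.
           (\<forall>t\<ge>0. h t \<ge> 0) \<longrightarrow> filterlim (\<lambda>t. h t / t\<^sup>2) at_top at_top \<longrightarrow>
           (SUP u\<in>H12_unit_ball.
              \<integral>\<^sup>+ x. ennreal (h \<bar>u x\<bar> * (exp (pi * (u x)\<^sup>2) - 1)) \<partial>lborel) = \<infinity>"
    by (intro allI impI) (rule supercritical_sup_infinite)
  show "\<forall>\<alpha> :: real. \<alpha> > pi \<longrightarrow>
           (SUP u\<in>H12_unit_ball. \<integral>\<^sup>+ x. ennreal (exp (\<alpha> * (u x)\<^sup>2) - 1) \<partial>lborel) = \<infinity>"
    by (intro allI impI) (rule exponent_sharp)
qed (rule critical_sup_finite)

end
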